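(* Let $G_1,\ldots,G_m$ be finite groups, $G=\prod_{i=1}^mG_i$, and $N_i=\prod_{j\ne i}G_j\trianglelefteq G$, so that $G/N_i\cong G_i$. Then there is a group isomorphism $$\mathcal U_{\mathrm{core}}(G)\cong\left(\prod_{i=1}^{m}\mathcal U_{\mathrm{core}}(G_i)\right)\times\bigcap_{i=1}^{m}\ker\left((-)^{N_i}:\mathcal U_{\mathrm{core}}(G)\longrightarrow\mathcal U_{\mathrm{core}}(G_i)\right).$$
   Context: For a finite group $G$, $\Omega(G)$ is the Burnside ring (Grothendieck ring of finite $G$-sets), with $\mathbb Z$-basis $[G/H]$, $(H)$ running over the conjugacy classes of subgroups of $G$, and $1_{\Omega(G)}=[G/G]$. With $\operatorname{core}_G(H)=\bigcap_{g\in G}gHg^{-1}$, $\mathfrak n_G:\Omega(G)\to\Omega(G)$ is the additive map with $\mathfrak n_G([G/H])=[G/\operatorname{core}_G(H)]$, and $\mathcal U_{\mathrm{core}}(G):=\{u\in\Omega(G)^\times\mid\mathfrak n_G(u)=1_{\Omega(G)}\}$, the group of core-trivial units (a subgroup of $\Omega(G)^\times$). For $N\trianglelefteq G$, $(-)^N:\Omega(G)\to\Omega(G/N)$ is the unital ring homomorphism $[X]\mapsto[X^N]$ (with $X^N$ viewed as a $G/N$-set). Here $G/N_i$ is identified with $G_i$ via the $i$-th projection, and $(-)^{N_i}$ restricts to a group homomorphism $\mathcal U_{\mathrm{core}}(G)\to\mathcal U_{\mathrm{core}}(G_i)$, whose kernel is meant. Known result available (Yoshida's unit criterion): a conjugation-invariant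 function $H\mapsto\varepsilon_H\in\{\pm1\}$ on subgroups of $G$ is of the form $\varepsilon_H=\varphi_H^G(u)$ for a unit $u$ of $\Omega(G)$ (where $\varphi_H^G([X])=\#X^H$) if and only if for every $K\le G$ the map $N_G(K)/K\to\{\pm1\}$, $gK\mapsto\varepsilon_{\langle K,g\rangle}/\varepsilon_K$, is a group homomorphism. *)

theory Defs
  imports "HOL-Algebra.Algebra"
begin

section \<open>Finite G-sets\<close>

type_synonym ('a, 'x) gset = "'x set \<times> ('a \<Rightarrow> 'x \<Rightarrow> 'x)"

definition finite_gset :: "('a, 'm) monoid_scheme \<Rightarrow> ('a, 'x) gset \<Rightarrow> bool" where
  "finite_gset G S \<longleftrightarrow> finite (fst S) \<and> group_action G (fst S) (snd S)"

definition gset_iso ::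
  "('a, 'm) monoid_scheme \<Rightarrow> ('a, 'x) gset \<Rightarrow> ('a, 'y) gset \<Rightarrow> bool" where
  "gset_iso G S T \<longleftrightarrow> (\<exists>f. bij_betw f (fst S) (fst T) \<and>
     (\<forall>g\<in>carrier G. \<forall>x\<in>fst S. f (snd S g x) = snd T g (f x)))"

text \<open>The library's \<open>group_action\<close> wants each group element to act by a function that is
  extensional on the underlying set; hence the restricted abstractions below.\<close>

definition gset_empty :: "('a, nat) gset" where
  "gset_empty = ({}, \<lambda>g. \<lambda>x\<in>{}. x)"

definition gset_point :: "('a, unit) gset" where
  "gset_point = (UNIV, \<lambda>g. \<lambda>x\<in>UNIV. x)"

definition gset_sum :: "('a, 'x) gset \<Rightarrow> ('a, 'y) gset \<Rightarrow> ('a, 'x + 'y) gset" where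
  "gset_sum S T =
     (fst S <+> fst T, \<lambda>g. \<lambda>z \<in> fst S <+> fst T. map_sum (snd S g) (snd T g) z)"

definition gset_prod :: "('a, 'x) gset \<Rightarrow> ('a, 'y) gset \<Rightarrow> ('a, 'x \<times> 'y) gset" where
  "gset_prod S T =
     (fst S \<times> fst T, \<lambda>g. \<lambda>z \<in> fst S \<times> fst T. map_prod (snd S g) (snd T g) z)"

definition gset_cosets :: "('a, 'm) monoid_scheme \<Rightarrow> 'a set \<Rightarrow> ('a, 'a set) gset" where
  "gset_cosets G H = (lcosets\<^bsub>G\<^esub> H, \<lambda>g. \<lambda>C \<in> lcosets\<^bsub>G\<^esub> H. g <#\<^bsub>G\<^esub> C)"

definition fixed_points :: "'a set \<Rightarrow> ('a, 'x) gset \<Rightarrow> 'x set" where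
  "fixed_points N S = {x \<in> fst S. \<forall>n\<in>N. snd S n x = x}"

text \<open>A coset \<open>C\<close> of \<open>N\<close> acts on the \<open>N\<close>-fixed points by the common value of
  \<open>x \<mapsto> g x\<close> for \<open>g \<in> C\<close>.\<close>

definition gset_fix :: "'a set \<Rightarrow> ('a, 'x) gset \<Rightarrow> ('a set, 'x) gset" where
  "gset_fix N S =
     (fixed_points N S, \<lambda>C. \<lambda>x \<in> fixed_points N S. the_elem ((\<lambda>g. snd S g x) ` C))"

definition gset_pullback :: "('b \<Rightarrow> 'a) \<Rightarrow> ('a, 'x) gset \<Rightarrow> ('b, 'x) gset" where
  "gset_pullback f S = (fst S, \<lambda>k. snd S (f k))"


section \<open>The Burnside ring\<close>

text \<open>The Grothendieck ring of finite \<open>G\<close>-sets. Its elements are classes of formal differences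
  \<open>A - B\<close>; every finite \<open>G\<close>-set is isomorphic to one on a set of natural numbers, so the
  representatives \<open>A\<close>, \<open>B\<close> are taken there. \<open>burnside_class G S T\<close> is the class of \<open>S - T\<close>,
  where \<open>S\<close> and \<open>T\<close> may live on arbitrary types: \<open>A - B\<close> represents the same element as
  \<open>S - T\<close> iff \<open>S + B + Z\<close> and \<open>A + T + Z\<close> are isomorphic for some finite \<open>G\<close>-set \<open>Z\<close>.\<close>

type_synonym 'a burnside = "(('a, nat) gset \<times> ('a, nat) gset) set"

definition burnside_class ::
  "('a, 'm) monoid_scheme \<Rightarrow> ('a, 'x) gset \<Rightarrow> ('a, 'y) gset \<Rightarrow> 'a burnside" where
  "burnside_class G S T = {(A, B). finite_gset G A \<and> finite_gset G B \<and>
     (\<exists>Z :: ('a, nat) gset. finite_gset G Z \<and>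
        gset_iso G (gset_sum (gset_sum S B) Z) (gset_sum (gset_sum A T) Z))}"

definition burnside_of :: "('a, 'm) monoid_scheme \<Rightarrow> ('a, 'x) gset \<Rightarrow> 'a burnside" where
  "burnside_of G S = burnside_class G S gset_empty"

definition burnside_ring :: "('a, 'm) monoid_scheme \<Rightarrow> 'a burnside ring" where
  "burnside_ring G = \<lparr>
     carrier = {burnside_class G A B | (A :: ('a, nat) gset) (B :: ('a, nat) gset).
                  finite_gset G A \<and> finite_gset G B},
     monoid.mult = (\<lambda>P Q. \<Union>(A, B)\<in>P. \<Union>(C, D)\<in>Q.
               burnside_class G (gset_sum (gset_prod A C) (gset_prod B D))
                                (gset_sum (gset_prod A D) (gset_prod B C))),
     one = burnside_of G gset_point,
     ring.zero = burnside_of G gset_empty,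
     ring.add = (\<lambda>P Q. \<Union>(A, B)\<in>P. \<Union>(C, D)\<in>Q.
               burnside_class G (gset_sum A C) (gset_sum B D))\<rparr>"

text \<open>The additive extension of \<open>[X] \<mapsto> [X\<^sup>N]\<close>.\<close>

definition burnside_fix ::
  "('a, 'm) monoid_scheme \<Rightarrow> 'a set \<Rightarrow> 'a burnside \<Rightarrow> 'a set burnside" where
  "burnside_fix G N P =
     (\<Union>(A, B)\<in>P. burnside_class (G Mod N) (gset_fix N A) (gset_fix N B))"

text \<open>Pullback of actions along a group homomorphism \<open>f\<close> from \<open>K\<close>.\<close>

definition burnside_pullback ::
  "('b, 'n) monoid_scheme \<Rightarrow> ('b \<Rightarrow> 'a) \<Rightarrow> 'a burnside \<Rightarrow> 'b burnside" where
  "burnside_pullback K f P =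
     (\<Union>(A, B)\<in>P. burnside_class K (gset_pullback f A) (gset_pullback f B))"


section \<open>Core-trivial units\<close>

definition subgroup_core :: "('a, 'm) monoid_scheme \<Rightarrow> 'a set \<Rightarrow> 'a set" where
  "subgroup_core G H = (\<Inter>g\<in>carrier G. g <#\<^bsub>G\<^esub> H #>\<^bsub>G\<^esub> inv\<^bsub>G\<^esub> g)"

text \<open>The classes \<open>[G/H]\<close> generate the additive group, so there is exactly one additive map
  as described; it is made extensional to be unique as a total function.\<close>

definition core_map :: "('a, 'm) monoid_scheme \<Rightarrow> 'a burnside \<Rightarrow> 'a burnside" where
  "core_map G = (THE f.
     f \<in> extensional (carrier (burnside_ring G)) \<and>
     f \<in> hom (add_monoid (burnside_ring G)) (add_monoid (burnside_ring G)) \<and>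
     (\<forall>H. subgroup H G \<longrightarrow>
        f (burnside_of G (gset_cosets G H)) =
          burnside_of G (gset_cosets G (subgroup_core G H))))"

definition core_trivial_units :: "('a, 'm) monoid_scheme \<Rightarrow> 'a burnside monoid" where
  "core_trivial_units G = (units_of (burnside_ring G))
     \<lparr>carrier := {u \<in> Units (burnside_ring G). core_map G u = \<one>\<^bsub>burnside_ring G\<^esub>}\<rparr>"


section \<open>Direct products\<close>

definition cofactor :: "'i set \<Rightarrow> ('i \<Rightarrow> ('a, 'm) monoid_scheme) \<Rightarrow> 'i \<Rightarrow> ('i \<Rightarrow> 'a) set" where
  "cofactor I G i = {x \<in> carrier (product_group I G). x i = \<one>\<^bsub>G i\<^esub>}"

text \<open>The set of elements with \<open>i\<close>-th coordinate \<open>y\<close> is the coset of the cofactor corresponding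
  to \<open>y\<close>, so \<open>fibre I G i\<close> is the inverse of the isomorphism from the quotient by the cofactor
  to \<open>G i\<close> induced by the \<open>i\<close>-th projection.\<close>

definition fibre ::
  "'i set \<Rightarrow> ('i \<Rightarrow> ('a, 'm) monoid_scheme) \<Rightarrow> 'i \<Rightarrow> 'a \<Rightarrow> ('i \<Rightarrow> 'a) set" where
  "fibre I G i y = {x \<in> carrier (product_group I G). x i = y}"

definition factor_fix ::
  "'i set \<Rightarrow> ('i \<Rightarrow> ('a, 'm) monoid_scheme) \<Rightarrow> 'i \<Rightarrow> ('i \<Rightarrow> 'a) burnside \<Rightarrow> 'a burnside" where
  "factor_fix I G i u =
     burnside_pullback (G i) (fibre I G i)
       (burnside_fix (product_group I G) (cofactor I G i) u)"

end

theory Submission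
  imports Defs "HOL-Library.Function_Algebras"
begin

text \<open>By Burnside's theorem the Burnside ring embeds into the ring of integer-valued functions on
  subgroups by marks, so all computations take place there. A unit \<open>u\<close> is a function \<open>f\<close> with values
  \<open>\<plusminus>1\<close>. For \<open>K\<close> normal, \<open>\<Sum>g. f \<langle>K, g\<rangle>\<close> depends only on the image of \<open>u\<close> under the core map,
  and it determines this image as \<open>K\<close> varies. Hence \<open>u\<close> is core-trivial iff \<open>f \<langle>K, g\<rangle> = 1\<close> for all
  normal \<open>K\<close> and all \<open>g\<close>. This condition is stable under inflation along the projections of a direct
  product; inflation from the factors splits the product of the maps \<open>(-)\<^sup>N\<close>, because fixed points of
  a cofactor, applied to something inflated from another factor, give a trivial action with
  \<open>f (G\<^sub>j) = 1\<close> virtual points.\<close>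

text \<open>The core map is given by a definite description, so existence and uniqueness must be
  settled before it can be computed. It is built as an explicit integral expression in orbit sums
  instead of coefficients in the basis of the \<open>[G/H]\<close>. For \<open>K\<close> normal, the
  orbit sum of \<open>G/H\<close> is \<open>|G|\<close> if \<open>K\<close> lies in \<open>H\<close>
  and 0 otherwise, and a normal subgroup lies in \<open>H\<close> iff it lies in the core of
  \<open>H\<close>. Hence orbit sums cannot tell \<open>G/H\<close> from \<open>G/core(H)\<close>,
  yet they separate the quotients by distinct normal subgroups. The description of core-trivial
  units in terms of normal subgroups is what makes both directions between \<open>G\<close> and a
  factor work: preimages of normal subgroups are normal, and so are their images under the
  surjective projections.\<close>

locale fin_group = group G for G (structure) +
  assumes finite_carrier: "finite (carrier G)"

section \<open>Finite G-sets\<close>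

lemma finite_gset_finite: "finite_gset G S \<Longrightarrow> finite (fst S)"
  by (simp add: finite_gset_def)

lemma gset_act_closed:
  "finite_gset G S \<Longrightarrow> g \<in> carrier G \<Longrightarrow> x \<in> fst S \<Longrightarrow> snd S g x \<in> fst S"
  by (meson finite_gset_def group_action.element_image)

lemma gset_act_mult:
  "finite_gset G S \<Longrightarrow> g \<in> carrier G \<Longrightarrow> h \<in> carrier G \<Longrightarrow> x \<in> fst S \<Longrightarrow>
    snd S (g \<otimes>\<^bsub>G\<^esub> h) x = snd S g (snd S h x)"
  by (meson finite_gset_def group_action.composition_rule)

lemma gset_act_one: "finite_gset G S \<Longrightarrow> x \<in> fst S \<Longrightarrow> snd S \<one>\<^bsub>G\<^esub> x = x"
  by (metis finite_gset_def group_action.id_eq_one restrict_apply)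

lemma gset_act_inv:
  "finite_gset G S \<Longrightarrow> g \<in> carrier G \<Longrightarrow> x \<in> fst S \<Longrightarrow> snd S (inv\<^bsub>G\<^esub> g) (snd S g x) = x"
  by (metis finite_gset_def group_action.orbit_sym_aux)

text \<open>An action in the library is a homomorphism into the group of extensional bijections of
  \<open>E\<close>. Bijectivity comes from the other axioms, since \<open>a (inv g)\<close> is a
  two-sided inverse of \<open>a g\<close>.\<close>

lemma (in group) group_actionI:
  assumes ext: "\<And>g. g \<in> carrier G \<Longrightarrow> a g \<in> extensional E"
    and cl: "\<And>g x. g \<in> carrier G \<Longrightarrow> x \<in> E \<Longrightarrow> a g x \<in> E"
    and one: "\<And>x. x \<in> E \<Longrightarrow> a \<one> x = x"
    and mult: "\<And>g h x. g \<in> carrier G \<Longrightarrow> h \<in> carrier G \<Longrightarrow> x \<in> E \<Longrightarrow> a (g \<otimes> h) x = a g (a h x)"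
  shows "group_action G E a"
proof -
  have inv: "a (inv g) (a g x) = x" "a g (a (inv g) x) = x" if "g \<in> carrier G" "x \<in> E" for g x
    using that mult[of "inv g" g x] mult[of g "inv g" x] one by auto
  have Bij: "a g \<in> Bij E" if g: "g \<in> carrier G" for g
    unfolding Bij_def using ext[OF g]
    by (auto intro!: bij_betw_byWitness[where f' = "a (inv g)"] simp: inv cl g)
  have "a (g \<otimes> h) = compose E (a g) (a h)" if "g \<in> carrier G" "h \<in> carrier G" for g h
    by (rule extensionalityI[of _ E]) (use that ext mult in \<open>auto simp: compose_def\<close>)
  then have "a \<in> hom G (BijGroup E)"
    by (intro homI) (simp_all add: BijGroup_def Bij)
  then show ?thesis
    by (simp add: group_action_def group_hom_def group_hom_axioms_def group_BijGroup is_group)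
qed

lemma (in group) finite_gsetI:
  assumes "finite (fst S)"
    and "\<And>g. g \<in> carrier G \<Longrightarrow> snd S g \<in> extensional (fst S)"
    and "\<And>g x. g \<in> carrier G \<Longrightarrow> x \<in> fst S \<Longrightarrow> snd S g x \<in> fst S"
    and "\<And>x. x \<in> fst S \<Longrightarrow> snd S \<one> x = x"
    and "\<And>g h x. g \<in> carrier G \<Longrightarrow> h \<in> carrier G \<Longrightarrow> x \<in> fst S \<Longrightarrow>
      snd S (g \<otimes> h) x = snd S g (snd S h x)"
  shows "finite_gset G S"
  unfolding finite_gset_def using assms by (blast intro: group_actionI)

definition gset_restrict :: "('a, 'x) gset \<Rightarrow> 'x set \<Rightarrow> ('a, 'x) gset" where
  "gset_restrict S Y = (Y, \<lambda>g. \<lambda>x\<in>Y. snd S g x)"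

text \<open>Structure transport along an injection. With a map into the naturals it produces the
  representatives from which the Burnside ring is built.\<close>

definition gset_transport :: "('x \<Rightarrow> 'y) \<Rightarrow> ('a, 'x) gset \<Rightarrow> ('a, 'y) gset" where
  "gset_transport f S = (f ` fst S, \<lambda>g. \<lambda>y \<in> f ` fst S. f (snd S g (the_inv_into (fst S) f y)))"

context group
begin

lemma finite_gset_empty: "finite_gset G gset_empty"
  by (rule finite_gsetI) (auto simp: gset_empty_def)

lemma finite_gset_point: "finite_gset G gset_point"
  by (rule finite_gsetI) (simp_all add: gset_point_def)

lemma finite_gset_sum: "finite_gset G S \<Longrightarrow> finite_gset G T \<Longrightarrow> finite_gset G (gset_sum S T)"
  by (rule finite_gsetI)
    (auto simp: gset_sum_def finite_gset_finite gset_act_closed gset_act_one gset_act_mult)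

lemma finite_gset_prod: "finite_gset G S \<Longrightarrow> finite_gset G T \<Longrightarrow> finite_gset G (gset_prod S T)"
  by (rule finite_gsetI)
    (auto simp: gset_prod_def finite_gset_finite gset_act_closed gset_act_one gset_act_mult)

lemma finite_gset_restrict:
  assumes "finite_gset G S" "Y \<subseteq> fst S"
    and "\<And>g x. g \<in> carrier G \<Longrightarrow> x \<in> Y \<Longrightarrow> snd S g x \<in> Y"
  shows "finite_gset G (gset_restrict S Y)"
  using assms finite_subset[OF assms(2) finite_gset_finite[OF assms(1)]]
  by (intro finite_gsetI) (auto simp: gset_restrict_def gset_act_one gset_act_mult subset_iff)

lemma finite_gset_transport:
  assumes "finite_gset G S" "inj_on f (fst S)"
  shows "finite_gset G (gset_transport f S)"
proof -
  have act: "snd (gset_transport f S) g (f x) = f (snd S g x)" if "x \<in> fst S" for g x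
    using assms(2) that by (simp add: gset_transport_def the_inv_into_f_f)
  show ?thesis
  proof (rule finite_gsetI)
    fix g h y assume gh: "g \<in> carrier G" "h \<in> carrier G" and "y \<in> fst (gset_transport f S)"
    then obtain x where x: "y = f x" "x \<in> fst S" by (auto simp: gset_transport_def)
    show "snd (gset_transport f S) (g \<otimes> h) y =
        snd (gset_transport f S) g (snd (gset_transport f S) h y)"
      using assms(1) gh x by (simp add: act gset_act_closed gset_act_mult)
  next
    fix g y assume g: "g \<in> carrier G" and "y \<in> fst (gset_transport f S)"
    then obtain x where x: "y = f x" "x \<in> fst S" by (auto simp: gset_transport_def)
    show "snd (gset_transport f S) g y \<in> fst (gset_transport f S)"
      using gset_act_closed[OF assms(1) g x(2)] x act by (simp add: gset_transport_def)
  next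
    fix y assume "y \<in> fst (gset_transport f S)"
    then obtain x where x: "y = f x" "x \<in> fst S" by (auto simp: gset_transport_def)
    show "snd (gset_transport f S) \<one> y = y"
      using assms(1) x by (simp add: act gset_act_one)
  qed (use assms(1) in \<open>simp_all add: gset_transport_def finite_gset_finite\<close>)
qed

lemma finite_gset_pullback:
  assumes S: "finite_gset K S" and p: "p \<in> hom G K" and K: "group K"
  shows "finite_gset G (gset_pullback p S)"
proof -
  interpret p: group_hom G K p
    using K p by (simp add: group_hom_def group_hom_axioms_def is_group)
  have "group_action G (fst S) (\<lambda>k. snd S (p k))"
  proof (rule group_actionI)
    have "snd S k \<in> extensional (fst S)" if "k \<in> carrier K" for k
      using S that unfolding finite_gset_def
      by (auto dest!: group_action.bij_prop0 simp: Bij_def)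
    then show "g \<in> carrier G \<Longrightarrow> snd S (p g) \<in> extensional (fst S)" for g by simp
  qed (use S in \<open>auto simp: gset_act_one gset_act_mult gset_act_closed\<close>)
  then show ?thesis
    using S by (simp add: finite_gset_def gset_pullback_def)
qed

end

lemma gset_iso_transport: 
  assumes "finite_gset G S" "inj_on f (fst S)"
  shows "gset_iso G S (gset_transport f S)"
  unfolding gset_iso_def using assms
  by (intro exI[of _ f]) (auto simp: gset_transport_def bij_betw_def the_inv_into_f_f)

section \<open>Marks\<close>

text \<open>Marks are indexed by arbitrary sets rather than subgroups; the value at a subset of the group
  is the classical mark of the subgroup which it generates.\<close>

definition mark :: "('a, 'm) monoid_scheme \<Rightarrow> ('a, 'x) gset \<Rightarrow> 'a set \<Rightarrow> int" where
  "mark G S H = int (card (fixed_points (H \<inter> carrier G) S))"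

lemma mark_iso:
  assumes "finite_gset G S" "finite_gset G T" "gset_iso G S T"
  shows "mark G S = mark G T"
proof
  fix H
  from assms(3) obtain f where f: "bij_betw f (fst S) (fst T)"
    "\<And>g x. g \<in> carrier G \<Longrightarrow> x \<in> fst S \<Longrightarrow> f (snd S g x) = snd T g (f x)"
    unfolding gset_iso_def by blast
  have fix_iff: "snd T g (f x) = f x \<longleftrightarrow> snd S g x = x" if "g \<in> carrier G" "x \<in> fst S" for g x
    using f(2)[OF that] gset_act_closed[OF assms(1) that] inj_on_eq_iff[OF bij_betw_imp_inj_on[OF f(1)]] that
    by metis
  have "bij_betw f (fixed_points (H \<inter> carrier G) S) (fixed_points (H \<inter> carrier G) T)"
    unfolding bij_betw_def
  proof
    show "inj_on f (fixed_points (H \<inter> carrier G) S)"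
      using f(1) by (auto simp: bij_betw_def fixed_points_def intro: inj_on_subset)
    show "f ` fixed_points (H \<inter> carrier G) S = fixed_points (H \<inter> carrier G) T"
      unfolding bij_betw_imp_surj_on[OF f(1), symmetric] fixed_points_def by (auto simp: fix_iff)
  qed
  then show "mark G S H = mark G T H"
    by (simp add: mark_def bij_betw_same_card)
qed

section \<open>Marks of sums, products and restrictions\<close>

lemma mark_empty [simp]: "mark G gset_empty = 0"
  by (auto simp: fun_eq_iff mark_def gset_empty_def fixed_points_def)

lemma mark_point [simp]: "mark G gset_point = 1"
  by (auto simp: fun_eq_iff mark_def gset_point_def fixed_points_def)

lemma fixed_points_finite: "finite_gset G S \<Longrightarrow> finite (fixed_points H S)"
  by (simp add: fixed_points_def finite_gset_finite)

lemma mark_sum: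
  assumes "finite_gset G S" "finite_gset G T"
  shows "mark G (gset_sum S T) = mark G S + mark G T"
proof
  fix H
  have "fixed_points (H \<inter> carrier G) (gset_sum S T) =
      Sum_Type.Plus (fixed_points (H \<inter> carrier G) S) (fixed_points (H \<inter> carrier G) T)"
    by (auto simp: fixed_points_def gset_sum_def)
  then show "mark G (gset_sum S T) H = (mark G S + mark G T) H"
    by (simp add: mark_def card_Plus fixed_points_finite[OF assms(1)] fixed_points_finite[OF assms(2)])
qed

lemma mark_prod:
  assumes "finite_gset G S" "finite_gset G T"
  shows "mark G (gset_prod S T) = mark G S * mark G T"
proof
  fix H
  have "fixed_points (H \<inter> carrier G) (gset_prod S T) =
      fixed_points (H \<inter> carrier G) S \<times> fixed_points (H \<inter> carrier G) T"
    by (auto simp: fixed_points_def gset_prod_def)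
  then show "mark G (gset_prod S T) H = (mark G S * mark G T) H"
    by (simp add: mark_def card_cartesian_product)
qed

text \<open>Each fixed point lies in exactly one of the two pieces. With \<open>Y\<close> an orbit,
  this removes the orbit in inductions on the number of points.\<close>

lemma mark_restrict:
  assumes "finite_gset G S" "Y \<subseteq> fst S"
  shows "mark G (gset_restrict S Y) + mark G (gset_restrict S (fst S - Y)) = mark G S"
proof
  fix H
  have "fixed_points (H \<inter> carrier G) S = fixed_points (H \<inter> carrier G) (gset_restrict S Y) \<union>
      fixed_points (H \<inter> carrier G) (gset_restrict S (fst S - Y))"
    using assms(2) by (auto simp: fixed_points_def gset_restrict_def)
  moreover have "fixed_points (H \<inter> carrier G) (gset_restrict S Y) \<inter>
      fixed_points (H \<inter> carrier G) (gset_restrict S (fst S - Y)) = {}"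
    by (auto simp: fixed_points_def gset_restrict_def)
  moreover have "finite (fixed_points (H \<inter> carrier G) (gset_restrict S Z))" if "Z \<subseteq> fst S" for Z
    using that finite_gset_finite[OF assms(1)] finite_subset
    by (fastforce simp: fixed_points_def gset_restrict_def)
  ultimately show "(mark G (gset_restrict S Y) + mark G (gset_restrict S (fst S - Y))) H = mark G S H"
    using assms(2) by (simp add: mark_def card_Un_disjoint)
qed

lemma (in group) mark_pullback:
  assumes "p \<in> hom G K"
  shows "mark G (gset_pullback p S) H = mark K S (p ` (H \<inter> carrier G))"
proof -
  have "p ` (H \<inter> carrier G) \<inter> carrier K = p ` (H \<inter> carrier G)"
    using assms by (auto simp: hom_def)
  then show ?thesis by (simp add: mark_def fixed_points_def gset_pullback_def)
qed

text \<open>Virtual marks are defined by G-sets of naturals, whereas coset spaces, for instance,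
  live on other types; this is the bridge.\<close>

lemma ex_nat_gset:
  fixes S :: "('a, 'x) gset"
  assumes "group G" "finite_gset G S"
  shows "\<exists>A :: ('a, nat) gset. finite_gset G A \<and> mark G A = mark G S"
proof -
  obtain f :: "'x \<Rightarrow> nat" where "inj_on f (fst S)"
    using finite_imp_inj_to_nat_seg[OF finite_gset_finite[OF assms(2)]] by blast
  then show ?thesis
    using group.finite_gset_transport[OF assms] gset_iso_transport[OF assms(2)] mark_iso[OF assms(2)]
    by metis
qed

section \<open>Orbits and stabilizers\<close>

definition gset_orbit :: "('a, 'm) monoid_scheme \<Rightarrow> ('a, 'x) gset \<Rightarrow> 'x \<Rightarrow> 'x set" where
  "gset_orbit G S x = (\<lambda>g. snd S g x) ` carrier G"

definition gset_stab :: "('a, 'm) monoid_scheme \<Rightarrow> ('a, 'x) gset \<Rightarrow> 'x \<Rightarrow> 'a set" where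
  "gset_stab G S x = {g \<in> carrier G. snd S g x = x}"

lemma gset_stab_subgroup: "finite_gset G S \<Longrightarrow> x \<in> fst S \<Longrightarrow> subgroup (gset_stab G S x) G"
  using group_action.stabilizer_subgroup[of G "fst S" "snd S" x]
  by (simp add: finite_gset_def gset_stab_def stabilizer_def)

lemma gset_orbit_stab:
  "finite_gset G S \<Longrightarrow> x \<in> fst S \<Longrightarrow> card (gset_orbit G S x) * card (gset_stab G S x) = order G"
  using group_action.orbit_stabilizer_theorem[of G "fst S" "snd S" x]
  by (simp add: finite_gset_def gset_stab_def stabilizer_def gset_orbit_def orbit_def
      Setcompr_eq_image)

text \<open>Invariance of \<open>Y\<close> and of its complement ensures that \<open>x\<close> and
  \<open>snd S g x\<close> are handled by the same branch of the combined bijection, so it is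
  equivariant.\<close>

lemma gset_iso_glue:
  assumes "gset_iso G (gset_restrict S Y) (gset_restrict T Z)"
    and "gset_iso G (gset_restrict S (fst S - Y)) (gset_restrict T (fst T - Z))"
    and "Y \<subseteq> fst S" "Z \<subseteq> fst T"
    and inv: "\<And>g x. g \<in> carrier G \<Longrightarrow> x \<in> Y \<Longrightarrow> snd S g x \<in> Y"
      "\<And>g x. g \<in> carrier G \<Longrightarrow> x \<in> fst S - Y \<Longrightarrow> snd S g x \<in> fst S - Y"
  shows "gset_iso G S T"
proof -
  obtain f1 where f1: "bij_betw f1 Y Z"
    "\<And>g x. g \<in> carrier G \<Longrightarrow> x \<in> Y \<Longrightarrow> f1 (snd S g x) = snd T g (f1 x)"
    using assms(1) unfolding gset_iso_def gset_restrict_def by (force dest: bij_betwE)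
  obtain f2 where f2: "bij_betw f2 (fst S - Y) (fst T - Z)"
    "\<And>g x. g \<in> carrier G \<Longrightarrow> x \<in> fst S - Y \<Longrightarrow> f2 (snd S g x) = snd T g (f2 x)"
    using assms(2) unfolding gset_iso_def gset_restrict_def by (force dest: bij_betwE)
  define f where "f = (\<lambda>x. if x \<in> Y then f1 x else f2 x)"
  have "bij_betw f (Y \<union> (fst S - Y)) (Z \<union> (fst T - Z))"
  proof (rule bij_betw_combine)
    show "bij_betw f Y Z"
      using f1(1) by (rule bij_betw_cong[THEN iffD1, rotated]) (simp add: f_def)
    show "bij_betw f (fst S - Y) (fst T - Z)"
      using f2(1) by (rule bij_betw_cong[THEN iffD1, rotated]) (simp add: f_def)
  qed auto
  then have "bij_betw f (fst S) (fst T)"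
    using assms(3,4) by (simp add: Un_absorb1)
  moreover have "f (snd S g x) = snd T g (f x)" if "g \<in> carrier G" "x \<in> fst S" for g x
    using f1(2)[of g x] f2(2)[of g x] inv(1)[of g x] inv(2)[of g x] that by (auto simp: f_def)
  ultimately show ?thesis by (auto simp: gset_iso_def)
qed

context group
begin

lemma gset_orbit_self: "finite_gset G S \<Longrightarrow> x \<in> fst S \<Longrightarrow> x \<in> gset_orbit G S x"
  unfolding gset_orbit_def using gset_act_one[of G S x] by (metis image_eqI one_closed)

lemma gset_orbit_subset: "finite_gset G S \<Longrightarrow> x \<in> fst S \<Longrightarrow> gset_orbit G S x \<subseteq> fst S"
  by (auto simp: gset_orbit_def gset_act_closed)

lemma gset_orbit_closed:
  assumes S: "finite_gset G S" "x \<in> fst S" and g: "g \<in> carrier G"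
  shows "y \<in> gset_orbit G S x \<Longrightarrow> snd S g y \<in> gset_orbit G S x"
    and "y \<in> fst S - gset_orbit G S x \<Longrightarrow> snd S g y \<in> fst S - gset_orbit G S x"
proof -
  have cl: "snd S h y \<in> gset_orbit G S x" if "y \<in> gset_orbit G S x" "h \<in> carrier G" for h y
    using that S unfolding gset_orbit_def by (auto simp: gset_act_mult[symmetric])
  then show "snd S g y \<in> gset_orbit G S x" if "y \<in> gset_orbit G S x"
    using that g by blast
  show "snd S g y \<in> fst S - gset_orbit G S x" if y: "y \<in> fst S - gset_orbit G S x"
    using cl[of "snd S g y" "inv g"] y g gset_act_inv[OF S(1) g, of y] gset_act_closed[OF S(1) g, of y]
    by auto
qed

lemma finite_gset_orbit:
  assumes "finite_gset G S" "x \<in> fst S"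
  shows "finite_gset G (gset_restrict S (gset_orbit G S x))"
    and "finite_gset G (gset_restrict S (fst S - gset_orbit G S x))"
  using gset_orbit_closed[OF assms] gset_orbit_subset[OF assms]
  by (auto intro!: finite_gset_restrict[OF assms(1)])

text \<open>Which elements of the group agree on \<open>x\<close> is decided by the stabilizer
  alone. This gives both well-definedness and injectivity of the map between two orbits with equal
  stabilizers.\<close>

lemma gset_act_eq_iff:
  assumes S: "finite_gset G S" "x \<in> fst S" and gh: "g \<in> carrier G" "h \<in> carrier G"
  shows "snd S g x = snd S h x \<longleftrightarrow> inv h \<otimes> g \<in> gset_stab G S x"
proof -
  have "snd S (inv h \<otimes> g) x = snd S (inv h) (snd S g x)"
    using S gh by (simp add: gset_act_mult)
  moreover have "snd S g x = snd S h (snd S (inv h) (snd S g x))"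
    using S gh gset_act_mult[OF S(1) gh(2), of "inv h" "snd S g x"] 
    by (simp add: gset_act_closed gset_act_one)
  ultimately show ?thesis
    using gset_act_inv[OF S(1) gh(2) S(2)] gh by (auto simp: gset_stab_def)
qed

lemma gset_iso_orbit:
  assumes S: "finite_gset G S" "x \<in> fst S" and T: "finite_gset G T" "y \<in> fst T"
    and stab: "gset_stab G S x = gset_stab G T y"
  shows "gset_iso G (gset_restrict S (gset_orbit G S x)) (gset_restrict T (gset_orbit G T y))"
proof -
  \<comment> \<open>The map sending \<open>g x\<close> to \<open>g y\<close>. Some \<open>g\<close>
    carrying \<open>x\<close> to \<open>z\<close> is chosen; equality of the stabilizers makes the
    result independent of this choice.\<close>
  define f where "f = (\<lambda>z. snd T (SOME g. g \<in> carrier G \<and> snd S g x = z) y)"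
  have f: "f (snd S g x) = snd T g y" if g: "g \<in> carrier G" for g
  proof -
    let ?h = "SOME h. h \<in> carrier G \<and> snd S h x = snd S g x"
    have h: "?h \<in> carrier G \<and> snd S ?h x = snd S g x"
      by (rule someI[of _ g]) (use g in simp)
    then have "snd T ?h y = snd T g y"
      using gset_act_eq_iff[OF S _ g, of ?h] gset_act_eq_iff[OF T _ g, of ?h] stab by simp
    then show ?thesis by (simp add: f_def)
  qed
  have "inj_on f (gset_orbit G S x)"
    by (rule inj_onI)
      (auto simp: gset_orbit_def f gset_act_eq_iff[OF S] gset_act_eq_iff[OF T] stab)
  moreover have "f ` gset_orbit G S x = gset_orbit G T y"
    by (auto simp: gset_orbit_def f image_image)
  moreover have "f (snd S g z) = snd T g (f z)" if "g \<in> carrier G" "z \<in> gset_orbit G S x" for g z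
    using that S T by (auto simp: gset_orbit_def f gset_act_mult[symmetric])
  ultimately show ?thesis
    unfolding gset_iso_def gset_restrict_def
    by (intro exI[of _ f]) (auto simp: bij_betw_def gset_orbit_closed[OF S])
qed

end

text \<open>The link from marks to stabilizers on which the matching of orbits rests.\<close>

lemma mark_pos_iff:
  assumes "finite_gset G S" "H \<subseteq> carrier G"
  shows "mark G S H \<noteq> 0 \<longleftrightarrow> (\<exists>x\<in>fst S. H \<subseteq> gset_stab G S x)"
proof -
  have "mark G S H \<noteq> 0 \<longleftrightarrow> fixed_points H S \<noteq> {}"
    using assms fixed_points_finite[OF assms(1)] by (simp add: mark_def Int_absorb2)
  then show ?thesis
    using assms(2) by (auto simp: fixed_points_def gset_stab_def)
qed

text \<open>Burnside's theorem: a point with maximal stabilizer in one G-set can be matched with a point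
  of the other one with the same stabilizer; remove both orbits.\<close>

theorem (in fin_group) gset_iso_of_mark_eq:
  fixes S :: "('a, 'x) gset" and T :: "('a, 'y) gset"
  assumes "finite_gset G S" "finite_gset G T"
    and "\<And>H. subgroup H G \<Longrightarrow> mark G S H = mark G T H"
  shows "gset_iso G S T"
  using assms
proof (induction "card (fst S)" arbitrary: S T rule: less_induct)
  case less
  note S = less.prems(1) and T = less.prems(2) and eq = less.prems(3)
  show ?case
  proof (cases "fst S = {}")
    case True
    \<comment> \<open>The mark at the trivial subgroup counts all points, so its vanishing forces
      \<open>T\<close> to be empty as well.\<close>
    have "mark G T {\<one>} = 0"
      using eq[OF triv_subgroup] mark_pos_iff[OF S, of "{\<one>}"] True by auto
    then have "fst T = {}"
      using mark_pos_iff[OF T, of "{\<one>}"] T by (auto simp: gset_stab_def gset_act_one)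
    then show ?thesis using True by (simp add: gset_iso_def bij_betw_def)
  next
    case False
    obtain x where x: "x \<in> fst S"
      and max: "\<And>z. z \<in> fst S \<Longrightarrow> card (gset_stab G S z) \<le> card (gset_stab G S x)"
      using obtains_MAX[OF finite_gset_finite[OF S] False, of "\<lambda>z. card (gset_stab G S z)"]
        Max_ge[OF finite_imageI[OF finite_gset_finite[OF S]]] by (metis imageI)
    have sub: "gset_stab G S z \<subseteq> carrier G" "gset_stab G T z' \<subseteq> carrier G" for z z'
      by (auto simp: gset_stab_def)
    \<comment> \<open>The stabilizer of \<open>x\<close> fixes \<open>x\<close>, so its mark on
      \<open>S\<close>, and hence on \<open>T\<close>, is nonzero. The same argument in the other
      direction leads back from \<open>y\<close> to a point \<open>z\<close> of
      \<open>S\<close>.\<close>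
    obtain y where y: "y \<in> fst T" "gset_stab G S x \<subseteq> gset_stab G T y"
      using eq[OF gset_stab_subgroup[OF S x]] mark_pos_iff[OF S sub(1)] mark_pos_iff[OF T sub(1)] x
      by (metis order_refl)
    obtain z where z: "z \<in> fst S" "gset_stab G T y \<subseteq> gset_stab G S z"
      using eq[OF gset_stab_subgroup[OF T y(1)]] mark_pos_iff[OF S sub(2)] mark_pos_iff[OF T sub(2)] y(1)
      by (metis order_refl)
    \<comment> \<open>The stabilizers of \<open>x\<close>, \<open>y\<close>, \<open>z\<close> form
      an increasing chain, and by the choice of \<open>x\<close> the last is not larger than the
      first; so the chain collapses.\<close>
    have "gset_stab G S x = gset_stab G S z"
      by (rule card_seteq) (use y z max[OF z(1)] finite_subset[OF sub(1) finite_carrier] in auto)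
    then have stab: "gset_stab G S x = gset_stab G T y"
      using y z by auto
    let ?Y = "gset_orbit G S x" and ?Z = "gset_orbit G T y"
    note fin = finite_gset_orbit[OF S x] finite_gset_orbit[OF T y(1)]
    have iso: "gset_iso G (gset_restrict S ?Y) (gset_restrict T ?Z)"
      by (rule gset_iso_orbit[OF S x T y(1) stab])
    have "gset_iso G (gset_restrict S (fst S - ?Y)) (gset_restrict T (fst T - ?Z))"
    proof (rule less.hyps)
      show "card (fst (gset_restrict S (fst S - ?Y))) < card (fst S)"
        unfolding gset_restrict_def fst_conv
        by (rule psubset_card_mono)
          (use finite_gset_finite[OF S] gset_orbit_self[OF S x] x in auto)
      fix H assume "subgroup H G"
      then show "mark G (gset_restrict S (fst S - ?Y)) H = mark G (gset_restrict T (fst T - ?Z)) H"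
        using mark_restrict[OF S gset_orbit_subset[OF S x]] eq[of H]
          mark_restrict[OF T gset_orbit_subset[OF T y(1)]] mark_iso[OF fin(1,3) iso]
        by (metis add_left_cancel plus_fun_apply)
    qed (use fin in auto)
    then show ?thesis
      by (rule gset_iso_glue[OF iso])
        (use gset_orbit_subset[OF S x] gset_orbit_subset[OF T y(1)] gset_orbit_closed[OF S x] in auto)
  qed
qed

section \<open>Coset spaces\<close>

lemma (in group) l_coset_eq_self_iff:
  assumes "subgroup H G" "g \<in> carrier G"
  shows "g <# H = H \<longleftrightarrow> g \<in> H"
  using assms coset_join3[of g H] subgroup.one_closed[OF assms(1)]
  by (force simp: l_coset_def)

context fin_group
begin

lemma finite_gset_cosets:
  assumes "subgroup H G"
  shows "finite_gset G (gset_cosets G H)"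
proof -
  have H: "H \<subseteq> carrier G" by (rule subgroup.subset[OF assms])
  have rep: "\<exists>a\<in>carrier G. C = a <# H" if "C \<in> lcosets H" for C
    using that by (auto simp: LCOSETS_def)
  have mem: "a <# H \<in> lcosets H" if "a \<in> carrier G" for a
    using that by (auto simp: LCOSETS_def)
  have act: "snd (gset_cosets G H) g (a <# H) = (g \<otimes> a) <# H" if "g \<in> carrier G" "a \<in> carrier G" for g a
    using that mem H by (simp add: gset_cosets_def lcos_m_assoc)
  show ?thesis
  proof (rule finite_gsetI)
    show "finite (fst (gset_cosets G H))"
      using finite_carrier by (simp add: gset_cosets_def LCOSETS_def)
  next
    fix g h C assume g: "g \<in> carrier G" "h \<in> carrier G" and C: "C \<in> fst (gset_cosets G H)"
    then obtain a where "a \<in> carrier G" "C = a <# H"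
      using rep by (auto simp: gset_cosets_def)
    with g show "snd (gset_cosets G H) (g \<otimes> h) C = snd (gset_cosets G H) g (snd (gset_cosets G H) h C)"
      by (simp add: act m_assoc)
  next
    fix g C assume g: "g \<in> carrier G" and C: "C \<in> fst (gset_cosets G H)"
    then obtain a where "a \<in> carrier G" "C = a <# H"
      using rep by (auto simp: gset_cosets_def)
    with g show "snd (gset_cosets G H) g C \<in> fst (gset_cosets G H)"
      using mem by (simp add: act) (simp add: gset_cosets_def)
  next
    fix C assume C: "C \<in> fst (gset_cosets G H)"
    then obtain a where "a \<in> carrier G" "C = a <# H"
      using rep by (auto simp: gset_cosets_def)
    then show "snd (gset_cosets G H) \<one> C = C"
      by (simp add: act)
  qed (simp add: gset_cosets_def)
qed

text \<open>The right-hand side is the conjugate of \<open>H\<close> by \<open>a\<close>, written as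
  a membership condition to which closure of a normal subgroup under conjugation applies
  directly.\<close>

lemma gset_stab_cosets:
  assumes H: "subgroup H G" and a: "a \<in> carrier G"
  shows "gset_stab G (gset_cosets G H) (a <# H) = {g \<in> carrier G. inv a \<otimes> g \<otimes> a \<in> H}"
proof -
  have sub: "H \<subseteq> carrier G" by (rule subgroup.subset[OF H])
  have "g <# (a <# H) = a <# H \<longleftrightarrow> inv a \<otimes> g \<otimes> a \<in> H" if g: "g \<in> carrier G" for g
  proof -
    have "g <# (a <# H) = a <# H \<longleftrightarrow> inv a <# (g <# (a <# H)) = inv a <# (a <# H)"
      using a g sub by (metis inv_closed inv_inv l_coset_subset_G lcos_m_assoc lcos_mult_one r_inv)
    also have "\<dots> \<longleftrightarrow> (inv a \<otimes> g \<otimes> a) <# H = H"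
      using a g sub by (simp add: lcos_m_assoc l_coset_subset_G lcos_mult_one m_assoc)
    finally show ?thesis using l_coset_eq_self_iff[OF H] a g by simp
  qed
  moreover have "a <# H \<in> lcosets H" using a by (auto simp: LCOSETS_def)
  ultimately show ?thesis
    by (auto simp: gset_stab_def gset_cosets_def)
qed

lemma gset_orbit_cosets:
  assumes "subgroup H G" "C \<in> lcosets H"
  shows "gset_orbit G (gset_cosets G H) C = lcosets H"
proof -
  have sub: "H \<subseteq> carrier G" by (rule subgroup.subset[OF assms(1)])
  obtain a where a: "a \<in> carrier G" "C = a <# H" using assms(2) by (auto simp: LCOSETS_def)
  have "b <# H \<in> (\<lambda>g. g <# C) ` carrier G" if "b \<in> carrier G" for b
  proof
    show "b <# H = (b \<otimes> inv a) <# C"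
      using that a sub by (simp add: lcos_m_assoc m_assoc)
  qed (use that a in simp)
  then have "lcosets H \<subseteq> gset_orbit G (gset_cosets G H) C"
    using assms(2) by (auto simp: gset_orbit_def gset_cosets_def LCOSETS_def)
  then show ?thesis
    using gset_orbit_subset[OF finite_gset_cosets[OF assms(1)], of C] assms(2)
    by (auto simp: gset_cosets_def)
qed

text \<open>Orbit-stabilizer at the level of marks: the coset \<open>H\<close> in \<open>G/H\<close>
  has stabilizer \<open>H\<close>, so its orbit is isomorphic to that of \<open>x\<close>, and by
  transitivity this orbit is all of \<open>G/H\<close>.\<close>

lemma mark_orbit:
  assumes S: "finite_gset G S" "x \<in> fst S"
  shows "mark G (gset_restrict S (gset_orbit G S x)) = mark G (gset_cosets G (gset_stab G S x))"
proof -
  let ?H = "gset_stab G S x"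
  have H: "subgroup ?H G" by (rule gset_stab_subgroup[OF S])
  note T = finite_gset_cosets[OF H]
  have mem: "?H \<in> lcosets ?H"
    using lcos_mult_one[OF subgroup.subset[OF H]] by (force simp: LCOSETS_def)
  then have mem': "?H \<in> fst (gset_cosets G ?H)" by (simp add: gset_cosets_def)
  have "gset_stab G (gset_cosets G ?H) ?H = ?H"
    using gset_stab_cosets[OF H one_closed] subgroup.subset[OF H]
    by (auto simp: lcos_mult_one[OF subgroup.subset[OF H]])
  then have "mark G (gset_restrict S (gset_orbit G S x)) =
      mark G (gset_restrict (gset_cosets G ?H) (gset_orbit G (gset_cosets G ?H) ?H))"
    by (intro mark_iso finite_gset_orbit gset_iso_orbit) (use S T mem' in auto)
  also have "\<dots> = mark G (gset_cosets G ?H)"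
    unfolding gset_orbit_cosets[OF H mem]
    by (auto simp: mark_def fun_eq_iff fixed_points_def gset_restrict_def gset_cosets_def
        intro!: arg_cong[where f = card])
  finally show ?thesis .
qed

text \<open>\<open>G/G\<close> is a point; this lets the core map be evaluated at the unit
  element.\<close>

lemma mark_cosets_carrier: "mark G (gset_cosets G (carrier G)) = 1"
proof
  fix H
  have "lcosets (carrier G) = {carrier G}"
    using coset_join3[OF _ subgroup_self] one_closed by (auto simp: LCOSETS_def)
  then have "fixed_points (H \<inter> carrier G) (gset_cosets G (carrier G)) = {carrier G}"
    using coset_join3[OF _ subgroup_self] by (auto simp: fixed_points_def gset_cosets_def)
  then show "mark G (gset_cosets G (carrier G)) H = 1 H"
    by (simp add: mark_def)
qed

end

section \<open>The Burnside ring as a ring of virtual marks\<close>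

text \<open>The image of the Burnside ring in its ghost ring, that is, in the integer functions
  under pointwise operations.\<close>

definition virtual_marks :: "('a, 'm) monoid_scheme \<Rightarrow> ('a set \<Rightarrow> int) set" where
  "virtual_marks G = {mark G A - mark G B | (A :: ('a, nat) gset) (B :: ('a, nat) gset).
     finite_gset G A \<and> finite_gset G B}"

text \<open>The inverse of the mark homomorphism. The fibre over \<open>f\<close> is nonempty
  exactly for virtual marks \<open>f\<close>, and then any of its members determines
  \<open>f\<close>; hence injectivity holds on \<open>virtual_marks\<close>.\<close>

definition class_of_mark :: "('a, 'm) monoid_scheme \<Rightarrow> ('a set \<Rightarrow> int) \<Rightarrow> 'a burnside" where
  "class_of_mark G f = {(A, B). finite_gset G A \<and> finite_gset G B \<and> mark G A - mark G B = f}"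

lemma inj_on_class_of_mark: "inj_on (class_of_mark G) (virtual_marks G)"
proof (rule inj_onI)
  fix f g assume f: "f \<in> virtual_marks G" and eq: "class_of_mark G f = class_of_mark G g"
  from f obtain A B where "(A, B) \<in> class_of_mark G f"
    by (auto simp: virtual_marks_def class_of_mark_def)
  then have "(A, B) \<in> class_of_mark G f" "(A, B) \<in> class_of_mark G g"
    using eq by auto
  then show "f = g" by (auto simp: class_of_mark_def)
qed

text \<open>Addition, multiplication, fixed points and pullback are all unions over representatives.
  If every representative contributes the same \<open>c\<close>, the union, being over a nonempty
  index set, equals \<open>c\<close>.\<close>

lemma UN_class_of_mark:
  assumes "f \<in> virtual_marks G"
    and "\<And>A B. finite_gset G A \<Longrightarrow> finite_gset G B \<Longrightarrow> mark G A - mark G B = f \<Longrightarrow> h A B = c"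
  shows "(\<Union>(A, B)\<in>class_of_mark G f. h A B) = c"
proof -
  from assms(1) obtain A B where "(A, B) \<in> class_of_mark G f"
    by (auto simp: virtual_marks_def class_of_mark_def)
  moreover have "h A B = c" if "(A, B) \<in> class_of_mark G f" for A B
    using assms(2) that by (auto simp: class_of_mark_def)
  ultimately show ?thesis by fast
qed

context fin_group
begin

lemma mark_diff_in_virtual_marks:
  fixes S :: "('a, 'x) gset" and T :: "('a, 'y) gset"
  assumes "finite_gset G S" "finite_gset G T"
  shows "mark G S - mark G T \<in> virtual_marks G"
proof -
  obtain A B :: "('a, nat) gset" where "finite_gset G A" "finite_gset G B"
    "mark G A = mark G S" "mark G B = mark G T"
    using ex_nat_gset[OF is_group assms(1)] ex_nat_gset[OF is_group assms(2)] by blast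
  then show ?thesis
    unfolding virtual_marks_def mem_Collect_eq by metis
qed

lemma mark_in_virtual_marks: "finite_gset G S \<Longrightarrow> mark G S \<in> virtual_marks G"
  using mark_diff_in_virtual_marks[OF _ finite_gset_empty, of S] by simp

text \<open>Marks are additive, so \<open>Z\<close> cancels in the integers. Conversely, Burnside's
  theorem turns equal marks into an isomorphism with \<open>Z\<close> empty.\<close>

lemma burnside_class_eq:
  assumes S: "finite_gset G S" and T: "finite_gset G T"
  shows "burnside_class G S T = class_of_mark G (mark G S - mark G T)"
proof -
  have iff: "(\<exists>Z :: ('a, nat) gset. finite_gset G Z \<and>
      gset_iso G (gset_sum (gset_sum S B) Z) (gset_sum (gset_sum A T) Z)) \<longleftrightarrow>
      mark G A - mark G B = mark G S - mark G T" (is "?L \<longleftrightarrow> ?R")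
    if A: "finite_gset G A" and B: "finite_gset G B" for A B :: "('a, nat) gset"
  proof
    assume ?L
    then obtain Z :: "('a, nat) gset" where Z: "finite_gset G Z"
      and iso: "gset_iso G (gset_sum (gset_sum S B) Z) (gset_sum (gset_sum A T) Z)" by blast
    have "mark G (gset_sum (gset_sum S B) Z) = mark G (gset_sum (gset_sum A T) Z)"
      by (rule mark_iso[OF _ _ iso]) (intro finite_gset_sum S T A B Z)+
    then have "mark G S + mark G B + mark G Z = mark G A + mark G T + mark G Z"
      by (simp only: mark_sum finite_gset_sum S T A B Z)
    then show ?R by (simp add: algebra_simps)
  next
    assume R: ?R
    have "gset_iso G (gset_sum (gset_sum S B) gset_empty) (gset_sum (gset_sum A T) gset_empty)"
    proof (rule gset_iso_of_mark_eq)
      have "mark G S + mark G B = mark G A + mark G T"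
        using R by (simp add: algebra_simps)
      then show "mark G (gset_sum (gset_sum S B) gset_empty) H =
          mark G (gset_sum (gset_sum A T) gset_empty) H" for H
        by (simp only: mark_sum finite_gset_sum finite_gset_empty S T A B)
    qed (intro finite_gset_sum finite_gset_empty S T A B)+
    then show ?L using finite_gset_empty by blast
  qed
  then show ?thesis
    unfolding burnside_class_def class_of_mark_def
    by (intro Collect_cong) (simp add: split_beta iff cong: conj_cong)
qed

lemma burnside_of_eq: "finite_gset G S \<Longrightarrow> burnside_of G S = class_of_mark G (mark G S)"
  by (simp add: burnside_of_def burnside_class_eq finite_gset_empty)

section \<open>Closure properties of the virtual marks\<close>

lemma virtual_marksE:
  assumes "f \<in> virtual_marks G"
  obtains A B :: "('a, nat) gset" where "finite_gset G A" "finite_gset G B" "f = mark G A - mark G B"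
  using assms by (auto simp: virtual_marks_def)

lemma virtual_marks_diff:
  assumes "f \<in> virtual_marks G" "g \<in> virtual_marks G"
  shows "f - g \<in> virtual_marks G"
proof -
  obtain A B :: "('a, nat) gset" where A: "finite_gset G A" "finite_gset G B" "f = mark G A - mark G B"
    using assms(1) by (rule virtual_marksE)
  obtain C D :: "('a, nat) gset" where C: "finite_gset G C" "finite_gset G D" "g = mark G C - mark G D"
    using assms(2) by (rule virtual_marksE)
  have "f - g = mark G (gset_sum A D) - mark G (gset_sum B C)"
    unfolding A(3) C(3) using A C by (simp add: mark_sum)
  then show ?thesis using A C by (simp add: mark_diff_in_virtual_marks finite_gset_sum)
qed

lemma virtual_marks_mult:
  assumes "f \<in> virtual_marks G" "g \<in> virtual_marks G"
  shows "f * g \<in> virtual_marks G"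
proof -
  obtain A B :: "('a, nat) gset" where A: "finite_gset G A" "finite_gset G B" "f = mark G A - mark G B"
    using assms(1) by (rule virtual_marksE)
  obtain C D :: "('a, nat) gset" where C: "finite_gset G C" "finite_gset G D" "g = mark G C - mark G D"
    using assms(2) by (rule virtual_marksE)
  have "f * g = mark G (gset_sum (gset_prod A C) (gset_prod B D)) -
      mark G (gset_sum (gset_prod A D) (gset_prod B C))"
    unfolding A(3) C(3) using A C
    by (simp add: mark_sum mark_prod finite_gset_prod algebra_simps)
  then show ?thesis
    using A C by (simp add: mark_diff_in_virtual_marks finite_gset_sum finite_gset_prod)
qed

lemma virtual_marks_zero: "0 \<in> virtual_marks G"
  using mark_in_virtual_marks[OF finite_gset_empty] by simp

lemma virtual_marks_one: "1 \<in> virtual_marks G"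
  using mark_in_virtual_marks[OF finite_gset_point] by simp

lemma virtual_marks_add:
  "f \<in> virtual_marks G \<Longrightarrow> g \<in> virtual_marks G \<Longrightarrow> f + g \<in> virtual_marks G"
  using virtual_marks_diff[OF _ virtual_marks_diff[OF virtual_marks_zero], of f g] by simp

lemma virtual_marks_sum:
  "(\<And>i. i \<in> I \<Longrightarrow> f i \<in> virtual_marks G) \<Longrightarrow> (\<Sum>i\<in>I. f i) \<in> virtual_marks G"
  by (induction I rule: infinite_finite_induct) (auto simp: virtual_marks_zero virtual_marks_add)

text \<open>In the function ring \<open>of_int c\<close> is the constant function \<open>c\<close>,
  so integral linear combinations can be written as sums of products.\<close>

lemma virtual_marks_of_int: "of_int c \<in> virtual_marks G"
proof (cases c rule: int_diff_cases)
  case (diff m n)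
  have "of_nat k \<in> virtual_marks G" for k
    using virtual_marks_sum[of "{..<k}" "\<lambda>_. 1"] virtual_marks_one by simp
  then show ?thesis using virtual_marks_diff by (simp add: diff)
qed

lemma carrier_burnside_ring: "carrier (burnside_ring G) = class_of_mark G ` virtual_marks G"
proof (intro Set.set_eqI iffI)
  fix u assume "u \<in> carrier (burnside_ring G)"
  then obtain A B :: "('a, nat) gset"
    where "finite_gset G A" "finite_gset G B" "u = burnside_class G A B"
    by (simp add: burnside_ring_def) blast
  then show "u \<in> class_of_mark G ` virtual_marks G"
    by (simp add: burnside_class_eq mark_diff_in_virtual_marks)
next
  fix u assume "u \<in> class_of_mark G ` virtual_marks G"
  then obtain A B :: "('a, nat) gset"
    where "finite_gset G A" "finite_gset G B" "u = class_of_mark G (mark G A - mark G B)"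
    unfolding virtual_marks_def by blast
  then show "u \<in> carrier (burnside_ring G)"
    unfolding burnside_ring_def partial_object.simps
    by (metis (mono_tags, lifting) burnside_class_eq mem_Collect_eq)
qed

lemma burnside_ring_one: "\<one>\<^bsub>burnside_ring G\<^esub> = class_of_mark G 1"
  by (simp add: burnside_ring_def burnside_of_eq finite_gset_point)

lemma burnside_ring_add:
  assumes "f \<in> virtual_marks G" "g \<in> virtual_marks G"
  shows "class_of_mark G f \<oplus>\<^bsub>burnside_ring G\<^esub> class_of_mark G g = class_of_mark G (f + g)"
  unfolding burnside_ring_def ring.simps
  by (intro UN_class_of_mark assms)
    (simp add: burnside_class_eq finite_gset_sum mark_sum algebra_simps)

lemma burnside_ring_mult:
  assumes "f \<in> virtual_marks G" "g \<in> virtual_marks G"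
  shows "class_of_mark G f \<otimes>\<^bsub>burnside_ring G\<^esub> class_of_mark G g = class_of_mark G (f * g)"
  unfolding burnside_ring_def monoid.simps
  by (intro UN_class_of_mark assms)
    (auto simp: burnside_class_eq finite_gset_sum finite_gset_prod mark_sum mark_prod algebra_simps)

text \<open>Splitting off orbits one by one shows that the transitive G-sets generate the additive
  group. Closure under differences suffices, because \<open>f + g = f - (0 - g)\<close>.\<close>

lemma virtual_marks_induct [consumes 1, case_names cosets diff]:
  assumes "f \<in> virtual_marks G"
    and cosets: "\<And>H. subgroup H G \<Longrightarrow> P (mark G (gset_cosets G H))"
    and diff: "\<And>f g. f \<in> virtual_marks G \<Longrightarrow> g \<in> virtual_marks G \<Longrightarrow> P f \<Longrightarrow> P g \<Longrightarrow> P (f - g)"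
  shows "P f"
proof -
  \<comment> \<open>Zero is obtained as the mark of \<open>G/G\<close> minus itself.\<close>
  have zero: "P 0"
    using diff[OF mark_in_virtual_marks mark_in_virtual_marks, OF finite_gset_cosets finite_gset_cosets,
        OF subgroup_self subgroup_self] cosets[OF subgroup_self] by simp
  have add: "P (f + g)" if "f \<in> virtual_marks G" "g \<in> virtual_marks G" "P f" "P g" for f g
    using diff[OF that(1) virtual_marks_diff, OF virtual_marks_zero that(2) that(3)]
      diff[OF virtual_marks_zero that(2) zero that(4)] by simp
  have mark: "P (mark G S)" if "finite_gset G S" for S :: "('a, nat) gset"
    using that
  proof (induction "card (fst S)" arbitrary: S rule: less_induct)
    case less
    note S = less.prems
    show ?case
    proof (cases "fst S = {}")
      case True
      then have "mark G S = 0" by (auto simp: mark_def fun_eq_iff fixed_points_def)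
      then show ?thesis using zero by simp
    next
      case False
      then obtain x where x: "x \<in> fst S" by blast
      let ?Y = "gset_orbit G S x"
      note fin = finite_gset_orbit[OF S x]
      have "P (mark G (gset_restrict S ?Y))"
        unfolding mark_orbit[OF S x] by (rule cosets[OF gset_stab_subgroup[OF S x]])
      moreover have "P (mark G (gset_restrict S (fst S - ?Y)))"
      proof (rule less.hyps[OF _ fin(2)])
        show "card (fst (gset_restrict S (fst S - ?Y))) < card (fst S)"
          unfolding gset_restrict_def fst_conv
          by (rule psubset_card_mono)
            (use finite_gset_finite[OF S] gset_orbit_self[OF S x] x in auto)
      qed
      ultimately show ?thesis
        using add[OF mark_in_virtual_marks[OF fin(1)] mark_in_virtual_marks[OF fin(2)]]
          mark_restrict[OF S gset_orbit_subset[OF S x]] by simp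
    qed
  qed
  obtain A B :: "('a, nat) gset" where "finite_gset G A" "finite_gset G B" "f = mark G A - mark G B"
    using assms(1) by (rule virtual_marksE)
  then show ?thesis using diff mark mark_in_virtual_marks by blast
qed

end

section \<open>The core map\<close>

text \<open>The weights \<open>\<mu>\<close> form row \<open>N\<close> of the inverse of the
  inclusion matrix of \<open>P\<close>. They are found by induction on the number of members
  strictly above \<open>N\<close>: the indicator of \<open>N \<subseteq> L\<close> exceeds that of
  \<open>L = N\<close> by the indicators of \<open>L = M\<close> for \<open>M\<close> strictly above
  \<open>N\<close>, and these are available by induction.\<close>

lemma moebius_inversion_subset:
  assumes "finite P" "N \<in> P"
  shows "\<exists>\<mu> :: 'a set \<Rightarrow> int. \<forall>L\<in>P. (\<Sum>K\<in>P. \<mu> K * of_bool (K \<subseteq> L)) = of_bool (L = N)"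
  using assms(2)
proof (induction "card {M \<in> P. N \<subset> M}" arbitrary: N rule: less_induct)
  case less
  let ?A = "{M \<in> P. N \<subset> M}"
  have "\<exists>\<mu> :: 'a set \<Rightarrow> int. \<forall>L\<in>P. (\<Sum>K\<in>P. \<mu> K * of_bool (K \<subseteq> L)) = of_bool (L = M)"
    if "M \<in> ?A" for M
  proof (rule less.hyps)
    show "card {M' \<in> P. M \<subset> M'} < card ?A"
      by (rule psubset_card_mono) (use that assms(1) in auto)
  qed (use that in auto)
  then obtain m :: "'a set \<Rightarrow> 'a set \<Rightarrow> int"
    where m: "\<And>M L. M \<in> ?A \<Longrightarrow> L \<in> P \<Longrightarrow> (\<Sum>K\<in>P. m M K * of_bool (K \<subseteq> L)) = of_bool (L = M)"
    by metis
  let ?\<mu> = "\<lambda>K. of_bool (K = N) - (\<Sum>M\<in>?A. m M K)"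
  have "(\<Sum>K\<in>P. ?\<mu> K * of_bool (K \<subseteq> L)) = of_bool (L = N)" if L: "L \<in> P" for L
  proof -
    have "(\<Sum>K\<in>P. ?\<mu> K * of_bool (K \<subseteq> L)) =
        (\<Sum>K\<in>P. of_bool (K = N) * of_bool (K \<subseteq> L)) - (\<Sum>K\<in>P. \<Sum>M\<in>?A. m M K * of_bool (K \<subseteq> L))"
      by (simp only: left_diff_distrib sum_subtractf sum_distrib_right)
    also have "(\<Sum>K\<in>P. of_bool (K = N) * of_bool (K \<subseteq> L)) = (of_bool (N \<subseteq> L) :: int)"
    proof -
      have "(\<Sum>K\<in>P. of_bool (K = N) * of_bool (K \<subseteq> L)) =
          (\<Sum>K\<in>P. if K = N then of_bool (N \<subseteq> L) else (0 :: int))"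
        by (intro sum.cong) auto
      then show ?thesis using less.prems assms(1) by simp
    qed
    also have "(\<Sum>K\<in>P. \<Sum>M\<in>?A. m M K * of_bool (K \<subseteq> L)) = (\<Sum>M\<in>?A. of_bool (L = M))"
      by (subst sum.swap) (simp add: m L)
    also have "\<dots> = of_bool (N \<subset> L)"
      using L assms(1) by (simp add: of_bool_def)
    finally show ?thesis by (auto simp: of_bool_def)
  qed
  then show ?case by (intro exI[of _ ?\<mu>]) blast
qed

lemma (in group) inv_mult_cancel:
  assumes "x \<in> carrier G" "y \<in> carrier G"
  shows "inv x \<otimes> (x \<otimes> y) = y" "x \<otimes> (inv x \<otimes> y) = y"
  using assms by (simp_all add: m_assoc[symmetric])

text \<open>On the class of a G-set \<open>X\<close> and for \<open>K\<close> normal, this is \<open>|G|\<close> times the number of orbits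
  on \<open>X\<^sup>K\<close>, by the Cauchy-Frobenius lemma.\<close>

definition orbit_sum :: "('a, 'm) monoid_scheme \<Rightarrow> 'a set \<Rightarrow> ('a set \<Rightarrow> int) \<Rightarrow> int" where
  "orbit_sum G K f = (\<Sum>g\<in>carrier G. f (insert g K))"

lemma orbit_sum_diff: "orbit_sum G K (f - g) = orbit_sum G K f - orbit_sum G K g"
  by (simp add: orbit_sum_def sum_subtractf)

lemma orbit_sum_add: "orbit_sum G K (f + g) = orbit_sum G K f + orbit_sum G K g"
  by (simp add: orbit_sum_def sum.distrib)

text \<open>The marks of the core-trivial units, as \<open>carrier_core_trivial_units\<close>
  confirms. The set \<open>insert g K\<close> stands for the subgroup generated by \<open>K\<close>
  and \<open>g\<close>, at which a virtual mark has the same value.\<close>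

definition core_trivial_marks :: "('a, 'm) monoid_scheme \<Rightarrow> ('a set \<Rightarrow> int) set" where
  "core_trivial_marks G = {f \<in> virtual_marks G. f * f = 1 \<and>
     (\<forall>K. K \<lhd> G \<longrightarrow> (\<forall>g\<in>carrier G. f (insert g K) = 1))}"

context fin_group
begin

text \<open>A normal \<open>K\<close> fixes either every coset of \<open>H\<close> or none. If none,
  all terms vanish; otherwise the pairs of an element and a coset fixed by it are counted in two
  ways, and \<open>G/H\<close> is a single orbit.\<close>

lemma orbit_sum_cosets:
  assumes K: "K \<lhd> G" and H: "subgroup H G"
  shows "orbit_sum G K (mark G (gset_cosets G H)) = int (order G) * of_bool (K \<subseteq> H)"
proof -
  let ?S = "gset_cosets G H"
  note S = finite_gset_cosets[OF H]
  have fst: "fst ?S = lcosets H" by (simp add: gset_cosets_def)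
  have Kc: "K \<subseteq> carrier G" by (rule subgroup.subset[OF normal_imp_subgroup[OF K]])
  \<comment> \<open>The stabilizers of cosets are the conjugates of \<open>H\<close>, and a normal
    \<open>K\<close> lies in one conjugate iff it lies in \<open>H\<close>.\<close>
  have stab: "K \<subseteq> gset_stab G ?S C \<longleftrightarrow> K \<subseteq> H" if "C \<in> fst ?S" for C
  proof -
    have "C \<in> lcosets H" using that by (simp only: fst)
    then obtain a where a: "a \<in> carrier G" "C = a <# H" by (auto simp: LCOSETS_def)
    have "K \<subseteq> gset_stab G ?S C \<longleftrightarrow> (\<forall>k\<in>K. inv a \<otimes> k \<otimes> a \<in> H)"
      using Kc by (auto simp: a gset_stab_cosets[OF H])
    also have "\<dots> \<longleftrightarrow> K \<subseteq> H"
    proof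
      assume *: "\<forall>k\<in>K. inv a \<otimes> k \<otimes> a \<in> H"
      show "K \<subseteq> H"
      proof
        fix k assume k: "k \<in> K"
        have "a \<otimes> k \<otimes> inv a \<in> K" using normal.inv_op_closed2[OF K a(1) k] .
        then have "inv a \<otimes> (a \<otimes> k \<otimes> inv a) \<otimes> a \<in> H" using * by blast
        moreover have "inv a \<otimes> (a \<otimes> k \<otimes> inv a) \<otimes> a = k"
          using a(1) subsetD[OF Kc k] by (simp add: m_assoc inv_mult_cancel)
        ultimately show "k \<in> H" by simp
      qed
    qed (use normal.inv_op_closed1[OF K a(1)] in blast)
    finally show ?thesis .
  qed
  show ?thesis
  proof (cases "K \<subseteq> H")
    case False
    have "mark G ?S (insert g K) = 0" if "g \<in> carrier G" for g
    proof -
      have "\<not> (\<exists>C\<in>fst ?S. insert g K \<subseteq> gset_stab G ?S C)"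
        using stab False by blast
      moreover have "insert g K \<subseteq> carrier G" using that Kc by simp
      ultimately show ?thesis using mark_pos_iff[OF S] by blast
    qed
    then show ?thesis using False by (simp add: orbit_sum_def)
  next
    case True
    have "mark G ?S (insert g K) = (\<Sum>C\<in>fst ?S. of_bool (g \<in> gset_stab G ?S C))"
      if g: "g \<in> carrier G" for g
    proof -
      have "fixed_points (insert g K \<inter> carrier G) ?S = {C \<in> fst ?S. insert g K \<subseteq> gset_stab G ?S C}"
        using Kc g by (auto simp: fixed_points_def gset_stab_def)
      also have "\<dots> = fst ?S \<inter> {C. g \<in> gset_stab G ?S C}"
        using stab True by auto
      finally show ?thesis using finite_gset_finite[OF S] by (simp add: mark_def)
    qed
    then have "orbit_sum G K (mark G ?S) =
        (\<Sum>g\<in>carrier G. \<Sum>C\<in>fst ?S. of_bool (g \<in> gset_stab G ?S C))"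
      by (simp add: orbit_sum_def)
    also have "\<dots> = (\<Sum>C\<in>fst ?S. \<Sum>g\<in>carrier G. of_bool (g \<in> gset_stab G ?S C))"
      by (rule sum.swap)
    also have "\<dots> = (\<Sum>C\<in>fst ?S. int (card (gset_stab G ?S C)))"
      using finite_carrier by (intro sum.cong refl) (auto simp: gset_stab_def intro!: arg_cong[where f = card])
    finally have sum: "orbit_sum G K (mark G ?S) = (\<Sum>C\<in>fst ?S. int (card (gset_stab G ?S C)))" .
    \<comment> \<open>By transitivity the extra factor is the orbit length of each coset, so every
      summand becomes \<open>|G|\<close> by the orbit-stabilizer theorem. The factor is cancelled at
      the end.\<close>
    have "int (card (fst ?S)) * orbit_sum G K (mark G ?S) =
        (\<Sum>C\<in>fst ?S. int (card (gset_orbit G ?S C) * card (gset_stab G ?S C)))"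
      unfolding sum sum_distrib_left using gset_orbit_cosets[OF H] by (simp add: fst)
    also have "\<dots> = int (card (fst ?S)) * int (order G)"
      by (simp add: gset_orbit_stab[OF S])
    finally have "int (card (fst ?S)) * orbit_sum G K (mark G ?S) = int (card (fst ?S)) * int (order G)" .
    moreover have "card (fst ?S) \<noteq> 0"
      using finite_gset_finite[OF S] one_closed by (auto simp: fst LCOSETS_def)
    ultimately show ?thesis using True by simp
  qed
qed

section \<open>The core of a subgroup\<close>

lemma mem_subgroup_core_iff:
  assumes H: "subgroup H G"
  shows "x \<in> subgroup_core G H \<longleftrightarrow> x \<in> carrier G \<and> (\<forall>g\<in>carrier G. inv g \<otimes> x \<otimes> g \<in> H)"
proof -
  have sub: "H \<subseteq> carrier G" by (rule subgroup.subset[OF H])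
  have "x \<in> g <# H #> inv g \<longleftrightarrow> x \<in> carrier G \<and> inv g \<otimes> x \<otimes> g \<in> H" if g: "g \<in> carrier G" for g
  proof
    assume "x \<in> g <# H #> inv g"
    then obtain h where "h \<in> H" "x = g \<otimes> h \<otimes> inv g" by (auto simp: l_coset_def r_coset_def)
    then show "x \<in> carrier G \<and> inv g \<otimes> x \<otimes> g \<in> H"
      using g subsetD[OF sub] by (auto simp: m_assoc inv_mult_cancel)
  next
    assume x: "x \<in> carrier G \<and> inv g \<otimes> x \<otimes> g \<in> H"
    have "x = g \<otimes> (inv g \<otimes> x \<otimes> g) \<otimes> inv g"
      using x g by (simp add: m_assoc inv_mult_cancel)
    then show "x \<in> g <# H #> inv g" using x unfolding l_coset_def r_coset_def by blast
  qed
  then show ?thesis using one_closed by (auto simp: subgroup_core_def)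
qed

lemma subgroup_core_subset: "subgroup H G \<Longrightarrow> subgroup_core G H \<subseteq> H"
  using mem_subgroup_core_iff[of H] by force

lemma subgroup_core_normal:
  assumes H: "subgroup H G"
  shows "subgroup_core G H \<lhd> G"
  unfolding normal_inv_iff
proof (intro conjI ballI)
  have conj: "inv g \<otimes> (x \<otimes> y) \<otimes> g = (inv g \<otimes> x \<otimes> g) \<otimes> (inv g \<otimes> y \<otimes> g)"
    if "g \<in> carrier G" "x \<in> carrier G" "y \<in> carrier G" for g x y
    using that by (simp add: m_assoc inv_mult_cancel)
  show "subgroup (subgroup_core G H) G"
  proof
    fix x assume x: "x \<in> subgroup_core G H"
    show "inv x \<in> subgroup_core G H"
      unfolding mem_subgroup_core_iff[OF H]
    proof (intro conjI ballI)
      show "inv x \<in> carrier G" using x by (simp add: mem_subgroup_core_iff[OF H])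
      fix g assume g: "g \<in> carrier G"
      have "inv (inv g \<otimes> x \<otimes> g) \<in> H"
        using x g by (intro subgroup.m_inv_closed[OF H]) (simp add: mem_subgroup_core_iff[OF H])
      then show "inv g \<otimes> inv x \<otimes> g \<in> H"
        using x g by (simp add: mem_subgroup_core_iff[OF H] inv_mult_group m_assoc)
    qed
  qed (auto simp: mem_subgroup_core_iff[OF H] conj subgroup.one_closed[OF H] subgroup.m_closed[OF H])
  fix a x assume a: "a \<in> carrier G" and x: "x \<in> subgroup_core G H"
  \<comment> \<open>Conjugation by \<open>a\<close> merely replaces the index \<open>g\<close> of
    the intersection by \<open>inv a \<otimes> g\<close>.\<close>
  have "inv g \<otimes> (a \<otimes> x \<otimes> inv a) \<otimes> g = inv (inv a \<otimes> g) \<otimes> x \<otimes> (inv a \<otimes> g)"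
    if "g \<in> carrier G" for g
    using a x that by (simp add: mem_subgroup_core_iff[OF H] inv_mult_group m_assoc)
  then show "a \<otimes> x \<otimes> inv a \<in> subgroup_core G H"
    using a x by (simp add: mem_subgroup_core_iff[OF H])
qed

text \<open>The core is the largest normal subgroup inside \<open>H\<close>. Therefore
  \<open>G/H\<close> and the quotient by the core of \<open>H\<close> have the same orbit
  sums.\<close>

lemma subset_subgroup_core_iff:
  assumes K: "K \<lhd> G" and H: "subgroup H G"
  shows "K \<subseteq> subgroup_core G H \<longleftrightarrow> K \<subseteq> H"
proof
  assume "K \<subseteq> H"
  then show "K \<subseteq> subgroup_core G H"
    using normal.inv_op_closed1[OF K] subgroup.subset[OF normal_imp_subgroup[OF K]]
    unfolding mem_subgroup_core_iff[OF H] subset_iff by blast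
qed (use subgroup_core_subset[OF H] in blast)

text \<open>The orbit sum of a transitive G-set is 0 or \<open>|G|\<close>, and divisibility passes
  to differences. This makes the integer division by \<open>|G|\<close> exact, and hence
  additive.\<close>

lemma order_dvd_orbit_sum:
  assumes "f \<in> virtual_marks G" "K \<lhd> G"
  shows "int (order G) dvd orbit_sum G K f"
  using assms(1)
proof (induction rule: virtual_marks_induct)
  case (diff f g)
  then show ?case using dvd_diff by (simp only: orbit_sum_diff)
qed (simp add: orbit_sum_cosets[OF assms(2)])

text \<open>By \<open>orbit_sum_cosets\<close>, Moebius inversion over the normal subgroups recovers the core
  of \<open>H\<close> from the orbit sums of \<open>G/H\<close>.\<close>

lemma ex_core_map_on_marks:
  obtains n where "\<And>f. f \<in> virtual_marks G \<Longrightarrow> n f \<in> virtual_marks G"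
    and "\<And>f g. f \<in> virtual_marks G \<Longrightarrow> g \<in> virtual_marks G \<Longrightarrow> n (f + g) = n f + n g"
    and "\<And>H. subgroup H G \<Longrightarrow>
      n (mark G (gset_cosets G H)) = mark G (gset_cosets G (subgroup_core G H))"
    and "\<And>f g. f \<in> virtual_marks G \<Longrightarrow> g \<in> virtual_marks G \<Longrightarrow>
      (\<And>K. K \<lhd> G \<Longrightarrow> orbit_sum G K f = orbit_sum G K g) \<Longrightarrow> n f = n g"
proof -
  define P where "P = {K. K \<lhd> G}"
  have "P \<subseteq> Pow (carrier G)"
    by (auto simp: P_def dest: normal_imp_subgroup subgroup.subset)
  then have finP: "finite P" using finite_carrier by (meson finite_Pow_iff finite_subset)
  obtain m :: "'a set \<Rightarrow> 'a set \<Rightarrow> int"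
    where m: "\<And>N L. N \<in> P \<Longrightarrow> L \<in> P \<Longrightarrow> (\<Sum>K\<in>P. m N K * of_bool (K \<subseteq> L)) = of_bool (L = N)"
    using moebius_inversion_subset[OF finP] by metis
  \<comment> \<open>The quotient generalizes the number of orbits on \<open>K\<close>-fixed points.
    On \<open>G/H\<close> it is the indicator of \<open>K\<close> lying in the core of
    \<open>H\<close>, so the weights \<open>m N\<close> turn it into the indicator of that core
    being \<open>N\<close>.\<close>
  define c where "c N f = (\<Sum>K\<in>P. m N K * (orbit_sum G K f div int (order G)))" for N f
  define n where "n f = (\<Sum>N\<in>P. of_int (c N f) * mark G (gset_cosets G N))" for f
  have order: "int (order G) \<noteq> 0" using order_gt_0_iff_finite finite_carrier by simp
  show thesis
  proof (rule that)
    fix f assume f: "f \<in> virtual_marks G"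
    show "n f \<in> virtual_marks G"
      unfolding n_def P_def
      by (intro virtual_marks_sum virtual_marks_mult virtual_marks_of_int mark_in_virtual_marks
          finite_gset_cosets normal_imp_subgroup) simp
    fix g assume g: "g \<in> virtual_marks G"
    have "c N (f + g) = c N f + c N g" for N
      unfolding c_def sum.distrib[symmetric]
      by (intro sum.cong refl)
        (auto simp: orbit_sum_add div_add P_def order_dvd_orbit_sum f g distrib_left)
    then show "n (f + g) = n f + n g"
      by (simp add: n_def sum.distrib distrib_right)
    show "n f = n g" if "\<And>K. K \<lhd> G \<Longrightarrow> orbit_sum G K f = orbit_sum G K g"
      using that by (simp add: n_def c_def P_def)
  next
    fix H assume H: "subgroup H G"
    have core: "subgroup_core G H \<in> P" by (simp add: P_def subgroup_core_normal[OF H])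
    have "c N (mark G (gset_cosets G H)) = of_bool (subgroup_core G H = N)" if "N \<in> P" for N
      unfolding m[OF that core, symmetric] c_def using order
      by (intro sum.cong refl) (auto simp: orbit_sum_cosets H P_def subset_subgroup_core_iff)
    then have "n (mark G (gset_cosets G H)) =
        (\<Sum>N\<in>P. of_int (of_bool (subgroup_core G H = N)) * mark G (gset_cosets G N))"
      unfolding n_def by (intro sum.cong refl) simp
    also have "\<dots> = (\<Sum>N\<in>P. if subgroup_core G H = N then mark G (gset_cosets G N) else 0)"
      by (intro sum.cong refl) simp
    also have "\<dots> = mark G (gset_cosets G (subgroup_core G H))"
      using finP core by simp
    finally show "n (mark G (gset_cosets G H)) = mark G (gset_cosets G (subgroup_core G H))" .
  qed
qed

text \<open>Any \<open>n\<close> with these properties, carried over to the Burnside ring, satisfies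
  the definite description. It is the only solution because an additive map is determined by its
  values on the classes \<open>[G/H]\<close>.\<close>

lemma core_map_class_of_mark:
  assumes n: "\<And>f. f \<in> virtual_marks G \<Longrightarrow> n f \<in> virtual_marks G"
    and add: "\<And>f g. f \<in> virtual_marks G \<Longrightarrow> g \<in> virtual_marks G \<Longrightarrow> n (f + g) = n f + n g"
    and cosets: "\<And>H. subgroup H G \<Longrightarrow>
      n (mark G (gset_cosets G H)) = mark G (gset_cosets G (subgroup_core G H))"
    and f: "f \<in> virtual_marks G"
  shows "core_map G (class_of_mark G f) = class_of_mark G (n f)"
proof -
  let ?R = "burnside_ring G"
  define F where "F = (\<lambda>u\<in>carrier ?R.
    class_of_mark G (n (the_inv_into (virtual_marks G) (class_of_mark G) u)))"
  have F: "F (class_of_mark G f) = class_of_mark G (n f)" if "f \<in> virtual_marks G" for f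
    using that
    by (simp add: F_def carrier_burnside_ring the_inv_into_f_f[OF inj_on_class_of_mark])
  note core = normal_imp_subgroup[OF subgroup_core_normal]
  have "core_map G = F"
    unfolding core_map_def
  proof (rule the_equality)
    have "F \<in> extensional (carrier ?R)" by (simp add: F_def)
    moreover have "F \<in> hom (add_monoid ?R) (add_monoid ?R)"
      by (rule homI) (auto simp: carrier_burnside_ring F n burnside_ring_add virtual_marks_add add)
    ultimately show "F \<in> extensional (carrier ?R) \<and> F \<in> hom (add_monoid ?R) (add_monoid ?R) \<and>
      (\<forall>H. subgroup H G \<longrightarrow> F (burnside_of G (gset_cosets G H)) =
        burnside_of G (gset_cosets G (subgroup_core G H)))"
      by (simp add: F burnside_of_eq finite_gset_cosets mark_in_virtual_marks cosets core)
  next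
    fix F' assume F': "F' \<in> extensional (carrier ?R) \<and> F' \<in> hom (add_monoid ?R) (add_monoid ?R) \<and>
      (\<forall>H. subgroup H G \<longrightarrow> F' (burnside_of G (gset_cosets G H)) =
        burnside_of G (gset_cosets G (subgroup_core G H)))"
    have F'_closed: "F' (class_of_mark G f) \<in> class_of_mark G ` virtual_marks G"
      if "f \<in> virtual_marks G" for f
      using F' that by (auto simp: hom_def carrier_burnside_ring)
    have F'_add: "F' (class_of_mark G (f + g)) = F' (class_of_mark G f) \<oplus>\<^bsub>?R\<^esub> F' (class_of_mark G g)"
      if "f \<in> virtual_marks G" "g \<in> virtual_marks G" for f g
      using F' that by (auto simp: hom_def carrier_burnside_ring burnside_ring_add[symmetric])
    have "F' (class_of_mark G f) = class_of_mark G (n f)" if "f \<in> virtual_marks G" for f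
      using that
    proof (induction rule: virtual_marks_induct)
      case (cosets H)
      then show ?case
        using F' by (simp add: burnside_of_eq finite_gset_cosets core assms(3))
    next
      case (diff f g)
      note d = virtual_marks_diff[OF diff(1,2)]
      obtain h where h: "h \<in> virtual_marks G" "F' (class_of_mark G (f - g)) = class_of_mark G h"
        using F'_closed[OF d] by auto
      \<comment> \<open>Additivity is applied to \<open>f = (f - g) + g\<close>. The cancellation of
        the value at \<open>g\<close> takes place among marks, where subtraction is
        available.\<close>
      have "class_of_mark G (n f) = class_of_mark G (h + n g)"
        using F'_add[OF d diff(2)] diff h by (simp add: burnside_ring_add n)
      then have "n f = h + n g"
        using inj_onD[OF inj_on_class_of_mark] diff(1,2) h(1) n virtual_marks_add by metis
      moreover have "n f = n (f - g) + n g"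
        using add[OF d diff(2)] by simp
      ultimately have "h = n (f - g)" by simp
      with h(2) show ?case by (simp only:)
    qed
    then show "F' = F"
      using F' F by (intro extensionalityI[of _ "carrier ?R"]) (auto simp: F_def carrier_burnside_ring)
  qed
  then show ?thesis by (simp add: F f)
qed

lemma orbit_sum_one: "orbit_sum G K 1 = int (order G)"
  by (simp add: orbit_sum_def order_def)

lemma core_map_eq_one_iff:
  assumes f: "f \<in> virtual_marks G" and unit: "f * f = 1"
  shows "core_map G (class_of_mark G f) = \<one>\<^bsub>burnside_ring G\<^esub> \<longleftrightarrow>
    (\<forall>K. K \<lhd> G \<longrightarrow> (\<forall>g\<in>carrier G. f (insert g K) = 1))"
proof -
  obtain n where n: "\<And>f. f \<in> virtual_marks G \<Longrightarrow> n f \<in> virtual_marks G"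
    and add: "\<And>f g. f \<in> virtual_marks G \<Longrightarrow> g \<in> virtual_marks G \<Longrightarrow> n (f + g) = n f + n g"
    and n_cosets: "\<And>H. subgroup H G \<Longrightarrow>
      n (mark G (gset_cosets G H)) = mark G (gset_cosets G (subgroup_core G H))"
    and cong: "\<And>f g. f \<in> virtual_marks G \<Longrightarrow> g \<in> virtual_marks G \<Longrightarrow>
      (\<And>K. K \<lhd> G \<Longrightarrow> orbit_sum G K f = orbit_sum G K g) \<Longrightarrow> n f = n g"
    using ex_core_map_on_marks by blast
  have "core_map G (class_of_mark G f) = class_of_mark G (n f)"
    by (rule core_map_class_of_mark[OF n add n_cosets f])
  then have "core_map G (class_of_mark G f) = \<one>\<^bsub>burnside_ring G\<^esub> \<longleftrightarrow> n f = 1"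
    using inj_on_eq_iff[OF inj_on_class_of_mark n[OF f] virtual_marks_one]
    by (simp add: burnside_ring_one)
  also have "\<dots> \<longleftrightarrow> (\<forall>K. K \<lhd> G \<longrightarrow> orbit_sum G K f = int (order G))"
  proof (intro iffI allI impI)
    fix K assume K: "K \<lhd> G" and nf: "n f = 1"
    \<comment> \<open>The core map preserves orbit sums at normal subgroups: on generators this is
      the fact that \<open>K\<close> lies in \<open>H\<close> iff it lies in the core of
      \<open>H\<close>.\<close>
    have "orbit_sum G K (n f) = orbit_sum G K f"
      using f
    proof (induction rule: virtual_marks_induct)
      case (cosets H)
      then show ?case
        by (simp add: n_cosets orbit_sum_cosets[OF K]
            normal_imp_subgroup[OF subgroup_core_normal] subset_subgroup_core_iff[OF K])
    next
      case (diff f g)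
      have "n f = n (f - g) + n g"
        using add[OF virtual_marks_diff[OF diff(1,2)] diff(2)] by simp
      then have "orbit_sum G K f = orbit_sum G K (n (f - g)) + orbit_sum G K g"
        using diff(3,4) orbit_sum_add by metis
      then have "orbit_sum G K (n (f - g)) = orbit_sum G K (f - g)"
        unfolding orbit_sum_diff by simp
      then show ?case by (simp only:)
    qed
    then show "orbit_sum G K f = int (order G)" using nf by (simp add: orbit_sum_one)
  next
    assume *: "\<forall>K. K \<lhd> G \<longrightarrow> orbit_sum G K f = int (order G)"
    \<comment> \<open>The unit is \<open>[G/G]\<close>, and the whole group is its own core, so
      \<open>n\<close> fixes 1. Since the orbit sums of \<open>f\<close> are those of 1,
      \<open>n\<close> takes the same value on both.\<close>
    have "subgroup_core G (carrier G) = carrier G"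
      using mem_subgroup_core_iff[OF subgroup_self] by auto
    then have "n 1 = 1"
      using n_cosets[OF subgroup_self] by (simp add: mark_cosets_carrier)
    moreover have "n f = n 1"
      by (rule cong[OF f virtual_marks_one]) (simp add: * orbit_sum_one)
    ultimately show "n f = 1" by simp
  qed
  also have "\<dots> \<longleftrightarrow> (\<forall>K. K \<lhd> G \<longrightarrow> (\<forall>g\<in>carrier G. f (insert g K) = 1))"
  proof -
    \<comment> \<open>The values of \<open>f\<close> are 1 or -1. A sum of \<open>|G|\<close> terms,
      each at most 1, equals \<open>|G|\<close> only if every term is 1.\<close>
    have le: "f H \<le> 1" for H
      using fun_cong[OF unit, of H] by (auto simp: zmult_eq_1_iff)
    have "orbit_sum G K f = int (order G) \<longleftrightarrow> (\<forall>g\<in>carrier G. f (insert g K) = 1)" for K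
      using sum_mono_inv[of "\<lambda>g. f (insert g K)" "carrier G" "\<lambda>_. 1"] le finite_carrier
      by (auto simp: orbit_sum_def order_def)
    then show ?thesis by simp
  qed
  finally show ?thesis .
qed

section \<open>Core-trivial units in terms of marks\<close>

lemma carrier_core_trivial_units:
  "carrier (core_trivial_units G) = class_of_mark G ` core_trivial_marks G"
proof -
  have "class_of_mark G f \<in> Units (burnside_ring G) \<longleftrightarrow> f * f = 1" if f: "f \<in> virtual_marks G" for f
  proof -
    have "class_of_mark G f \<in> Units (burnside_ring G) \<longleftrightarrow>
        (\<exists>g\<in>virtual_marks G. class_of_mark G (g * f) = class_of_mark G 1)"
      using f by (auto simp: Units_def carrier_burnside_ring burnside_ring_mult burnside_ring_one mult.commute)
    also have "\<dots> \<longleftrightarrow> (\<exists>g\<in>virtual_marks G. g * f = 1)"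
      by (intro bex_cong refl inj_on_eq_iff[OF inj_on_class_of_mark] virtual_marks_mult
          virtual_marks_one f)
    \<comment> \<open>A pointwise invertible integer function takes only the values 1 and -1, hence
      is its own inverse; \<open>f\<close> itself serves as the witness \<open>g\<close>.\<close>
    also have "\<dots> \<longleftrightarrow> f * f = 1"
      using f by (auto simp: fun_eq_iff zmult_eq_1_iff)
    finally show ?thesis .
  qed
  moreover have "Units (burnside_ring G) \<subseteq> class_of_mark G ` virtual_marks G"
    by (auto simp: Units_def carrier_burnside_ring)
  moreover have "carrier (core_trivial_units G) =
      {u \<in> Units (burnside_ring G). core_map G u = \<one>\<^bsub>burnside_ring G\<^esub>}"
    by (simp add: core_trivial_units_def)
  ultimately have "u \<in> carrier (core_trivial_units G) \<longleftrightarrow> (\<exists>f\<in>virtual_marks G. u = class_of_mark G f \<and>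
      f * f = 1 \<and> core_map G (class_of_mark G f) = \<one>\<^bsub>burnside_ring G\<^esub>)" for u
    by blast
  also have "(\<exists>f\<in>virtual_marks G. u = class_of_mark G f \<and>
      f * f = 1 \<and> core_map G (class_of_mark G f) = \<one>\<^bsub>burnside_ring G\<^esub>) \<longleftrightarrow>
      u \<in> class_of_mark G ` core_trivial_marks G" for u
    unfolding core_trivial_marks_def image_iff Bex_def mem_Collect_eq
    by (intro ex_cong1) (use core_map_eq_one_iff in metis)
  finally show ?thesis by (rule Set.set_eqI)
qed

lemma mult_core_trivial_units: "(\<otimes>\<^bsub>core_trivial_units G\<^esub>) = (\<otimes>\<^bsub>burnside_ring G\<^esub>)"
  by (simp add: core_trivial_units_def units_of_def)

lemma one_core_trivial_units: "\<one>\<^bsub>core_trivial_units G\<^esub> = class_of_mark G 1"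
  by (simp add: core_trivial_units_def units_of_def burnside_ring_one)

end

lemma core_trivial_marksD:
  assumes "f \<in> core_trivial_marks G"
  shows "f \<in> virtual_marks G" "f * f = 1"
    "K \<lhd> G \<Longrightarrow> g \<in> carrier G \<Longrightarrow> f (insert g K) = 1"
  using assms by (auto simp: core_trivial_marks_def)

section \<open>Fixed points of normal subgroups and pullbacks on marks\<close>

lemma (in group) finite_gset_fix:
  assumes N: "N \<lhd> G" and S: "finite_gset G S"
  shows "finite_gset (G Mod N) (gset_fix N S)"
    and "C \<in> carrier (G Mod N) \<Longrightarrow> g \<in> C \<Longrightarrow> x \<in> fixed_points N S \<Longrightarrow>
      snd (gset_fix N S) C x = snd S g x"
proof -
  have Nc: "N \<subseteq> carrier G" by (rule subgroup.subset[OF normal_imp_subgroup[OF N]])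
  have fst: "fst (gset_fix N S) = fixed_points N S" by (simp add: gset_fix_def)
  \<comment> \<open>Normality allows \<open>n \<otimes> g\<close> to be written as \<open>g\<close>
    times a conjugate of \<open>n\<close> in \<open>N\<close>, which fixes \<open>x\<close>; so the
    group preserves the \<open>N\<close>-fixed points.\<close>
  have closed: "snd S g x \<in> fixed_points N S" if g: "g \<in> carrier G" and x: "x \<in> fixed_points N S" for g x
  proof -
    have xS: "x \<in> fst S" using x by (simp add: fixed_points_def)
    have "snd S n (snd S g x) = snd S g x" if n: "n \<in> N" for n
    proof -
      have "n \<in> carrier G" using n Nc by blast
      then have "snd S n (snd S g x) = snd S (g \<otimes> (inv g \<otimes> n \<otimes> g)) x"
        using g xS by (simp add: gset_act_mult[OF S, symmetric] m_assoc inv_mult_cancel)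
      also have "\<dots> = snd S g (snd S (inv g \<otimes> n \<otimes> g) x)"
        using g xS \<open>n \<in> carrier G\<close> by (simp add: gset_act_mult[OF S])
      also have "snd S (inv g \<otimes> n \<otimes> g) x = x"
        using x normal.inv_op_closed1[OF N g n] by (simp add: fixed_points_def)
      finally show ?thesis .
    qed
    then show ?thesis using gset_act_closed[OF S g xS] by (simp add: fixed_points_def)
  qed
  \<comment> \<open>All elements of the coset move \<open>x\<close> to the same point, because
    \<open>snd S g x\<close> is again fixed by \<open>N\<close>. So \<open>the_elem\<close> is
    applied to a singleton.\<close>
  have act: "snd (gset_fix N S) (N #> g) x = snd S g x"
    if g: "g \<in> carrier G" and x: "x \<in> fixed_points N S" for g x
  proof -
    have "snd S (n \<otimes> g) x = snd S g x" if "n \<in> N" for n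
    proof -
      have "snd S (n \<otimes> g) x = snd S n (snd S g x)"
        using that Nc g x by (intro gset_act_mult[OF S]) (auto simp: fixed_points_def)
      then show ?thesis using closed[OF g x] that by (simp add: fixed_points_def)
    qed
    moreover have "(\<lambda>h. snd S h x) ` (N #> g) = (\<lambda>n. snd S (n \<otimes> g) x) ` N"
      by (auto simp: r_coset_def)
    moreover have "N \<noteq> {}" using subgroup.one_closed[OF normal_imp_subgroup[OF N]] by blast
    ultimately have "(\<lambda>h. snd S h x) ` (N #> g) = {snd S g x}" by auto
    then show ?thesis using x by (simp add: gset_fix_def)
  qed
  have rep: "\<exists>a\<in>carrier G. C = N #> a" if "C \<in> carrier (G Mod N)" for C
    using that by (auto simp: FactGroup_def RCOSETS_def)
  show "snd (gset_fix N S) C x = snd S g x"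
    if C: "C \<in> carrier (G Mod N)" and "g \<in> C" and "x \<in> fixed_points N S" for C g x
  proof -
    obtain a where a: "a \<in> carrier G" "C = N #> a" using rep[OF C] by blast
    then have "C = N #> g" "g \<in> carrier G"
      using repr_independence[OF _ a(1) normal_imp_subgroup[OF N], of g] \<open>g \<in> C\<close>
        r_coset_subset_G[OF Nc a(1)] by auto
    then show ?thesis using act that(3) by simp
  qed
  show "finite_gset (G Mod N) (gset_fix N S)"
  proof (rule group.finite_gsetI[OF normal.factorgroup_is_group[OF N]])
    fix C D x assume "C \<in> carrier (G Mod N)" "D \<in> carrier (G Mod N)"
      and x: "x \<in> fst (gset_fix N S)"
    then obtain a b where ab: "a \<in> carrier G" "C = N #> a" "b \<in> carrier G" "D = N #> b"
      using rep by metis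
    have "C \<otimes>\<^bsub>G Mod N\<^esub> D = N #> (a \<otimes> b)"
      using normal.rcos_sum[OF N ab(1,3)] ab by (simp add: FactGroup_def)
    then show "snd (gset_fix N S) (C \<otimes>\<^bsub>G Mod N\<^esub> D) x =
        snd (gset_fix N S) C (snd (gset_fix N S) D x)"
      using x ab closed by (simp add: fst act gset_act_mult[OF S] fixed_points_def)
  next
    fix C x assume "C \<in> carrier (G Mod N)" and x: "x \<in> fst (gset_fix N S)"
    then obtain a where "a \<in> carrier G" "C = N #> a"
      using rep by metis
    then show "snd (gset_fix N S) C x \<in> fst (gset_fix N S)"
      using x closed by (simp add: fst act)
  next
    fix x assume x: "x \<in> fst (gset_fix N S)"
    have "\<one>\<^bsub>G Mod N\<^esub> = N #> \<one>" using coset_mult_one[OF Nc] by (simp add: FactGroup_def)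
    then show "snd (gset_fix N S) \<one>\<^bsub>G Mod N\<^esub> x = x"
      using x act[of \<one> x] gset_act_one[OF S] by (simp add: fst fixed_points_def)
  qed (simp_all add: fst fixed_points_finite[OF S], simp add: gset_fix_def)
qed

text \<open>A point of the quotient action is fixed by a coset iff every element of that coset fixes
  it. \<open>N\<close> is listed separately since \<open>H\<close> may contain no coset at all,
  while the points must still be fixed by \<open>N\<close>.\<close>

lemma (in group) mark_fix:
  assumes N: "N \<lhd> G" and S: "finite_gset G S"
  shows "mark (G Mod N) (gset_fix N S) H = mark G S (N \<union> \<Union>(H \<inter> carrier (G Mod N)))"
proof -
  have Nc: "N \<subseteq> carrier G" by (rule subgroup.subset[OF normal_imp_subgroup[OF N]])
  have C: "C \<subseteq> carrier G" "C \<noteq> {}" if "C \<in> carrier (G Mod N)" for C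
  proof -
    obtain a where "a \<in> carrier G" "C = N #> a"
      using \<open>C \<in> carrier (G Mod N)\<close> by (auto simp: FactGroup_def RCOSETS_def)
    then show "C \<subseteq> carrier G" "C \<noteq> {}"
      using r_coset_subset_G[OF Nc] rcos_self[OF _ normal_imp_subgroup[OF N]] by auto
  qed
  have "(\<forall>C\<in>H \<inter> carrier (G Mod N). snd (gset_fix N S) C x = x) \<longleftrightarrow>
      (\<forall>g\<in>\<Union>(H \<inter> carrier (G Mod N)). snd S g x = x)" if x: "x \<in> fixed_points N S" for x
  proof -
    have "snd (gset_fix N S) C x = x \<longleftrightarrow> (\<forall>g\<in>C. snd S g x = x)" if "C \<in> carrier (G Mod N)" for C
      using C(2)[OF that] finite_gset_fix(2)[OF N S that _ x] by auto
    then show ?thesis by blast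
  qed
  then have "fixed_points (H \<inter> carrier (G Mod N)) (gset_fix N S) =
      fixed_points (N \<union> \<Union>(H \<inter> carrier (G Mod N))) S"
    by (auto simp: fixed_points_def gset_fix_def)
  moreover have "(N \<union> \<Union>(H \<inter> carrier (G Mod N))) \<inter> carrier G = N \<union> \<Union>(H \<inter> carrier (G Mod N))"
    using Nc C(1) by blast
  ultimately show ?thesis by (simp add: mark_def)
qed

context fin_group
begin

lemma fin_group_FactGroup: "N \<lhd> G \<Longrightarrow> fin_group (G Mod N)"
  using normal.factorgroup_is_group[of N G] finite_carrier
  by (simp add: fin_group_def fin_group_axioms_def carrier_FactGroup)

lemma burnside_fix_class_of_mark:
  assumes N: "N \<lhd> G" and f: "f \<in> virtual_marks G"
  shows "burnside_fix G N (class_of_mark G f) =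
      class_of_mark (G Mod N) (\<lambda>H. f (N \<union> \<Union>(H \<inter> carrier (G Mod N))))"
    and "(\<lambda>H. f (N \<union> \<Union>(H \<inter> carrier (G Mod N)))) \<in> virtual_marks (G Mod N)"
proof -
  interpret Q: fin_group "G Mod N" by (rule fin_group_FactGroup[OF N])
  have mark: "mark (G Mod N) (gset_fix N A) - mark (G Mod N) (gset_fix N B) =
      (\<lambda>H. (mark G A - mark G B) (N \<union> \<Union>(H \<inter> carrier (G Mod N))))"
    if "finite_gset G A" "finite_gset G B" for A B :: "('a, nat) gset"
    using that by (simp add: fun_eq_iff mark_fix[OF N])
  show "burnside_fix G N (class_of_mark G f) =
      class_of_mark (G Mod N) (\<lambda>H. f (N \<union> \<Union>(H \<inter> carrier (G Mod N))))"
    unfolding burnside_fix_def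
  proof (rule UN_class_of_mark[OF f])
    fix A B :: "('a, nat) gset" assume "finite_gset G A" "finite_gset G B" "mark G A - mark G B = f"
    then show "burnside_class (G Mod N) (gset_fix N A) (gset_fix N B) =
        class_of_mark (G Mod N) (\<lambda>H. f (N \<union> \<Union>(H \<inter> carrier (G Mod N))))"
      using mark Q.burnside_class_eq[OF finite_gset_fix(1)[OF N] finite_gset_fix(1)[OF N]] by metis
  qed
  obtain A B :: "('a, nat) gset" where "finite_gset G A" "finite_gset G B" "f = mark G A - mark G B"
    using f by (rule virtual_marksE)
  then show "(\<lambda>H. f (N \<union> \<Union>(H \<inter> carrier (G Mod N)))) \<in> virtual_marks (G Mod N)"
    using mark Q.mark_diff_in_virtual_marks[OF finite_gset_fix(1)[OF N] finite_gset_fix(1)[OF N]] by metis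
qed

lemma burnside_pullback_class_of_mark:
  fixes K :: "('k, 'n) monoid_scheme"
  assumes K: "fin_group K" and p: "p \<in> hom G K" and f: "f \<in> virtual_marks K"
  shows "burnside_pullback G p (class_of_mark K f) = class_of_mark G (\<lambda>H. f (p ` (H \<inter> carrier G)))"
    and "(\<lambda>H. f (p ` (H \<inter> carrier G))) \<in> virtual_marks G"
proof -
  interpret K: fin_group K by (rule K)
  note fin = finite_gset_pullback[OF _ p K.is_group]
  have mark: "mark G (gset_pullback p A) - mark G (gset_pullback p B) =
      (\<lambda>H. (mark K A - mark K B) (p ` (H \<inter> carrier G)))" for A B :: "('k, nat) gset"
    by (simp add: fun_eq_iff mark_pullback[OF p])
  show "burnside_pullback G p (class_of_mark K f) = class_of_mark G (\<lambda>H. f (p ` (H \<inter> carrier G)))"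
    unfolding burnside_pullback_def
  proof (rule UN_class_of_mark[OF f])
    fix A B :: "('k, nat) gset" assume "finite_gset K A" "finite_gset K B" "mark K A - mark K B = f"
    then show "burnside_class G (gset_pullback p A) (gset_pullback p B) =
        class_of_mark G (\<lambda>H. f (p ` (H \<inter> carrier G)))"
      using mark burnside_class_eq[OF fin fin] by metis
  qed
  obtain A B :: "('k, nat) gset" where "finite_gset K A" "finite_gset K B" "f = mark K A - mark K B"
    using f by (rule K.virtual_marksE)
  then show "(\<lambda>H. f (p ` (H \<inter> carrier G))) \<in> virtual_marks G"
    using mark mark_diff_in_virtual_marks[OF fin fin] by metis
qed

section \<open>Marks at generating sets\<close>

lemma virtual_mark_Int_carrier: "f \<in> virtual_marks G \<Longrightarrow> f (H \<inter> carrier G) = f H"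
  by (elim virtual_marksE) (simp add: mark_def)

text \<open>Stabilizers are subgroups, so a point fixed by \<open>H\<close> is fixed by all that
  \<open>H\<close> generates. This allows sets between \<open>H\<close> and its span to be exchanged
  for each other.\<close>

lemma virtual_mark_generate:
  assumes "f \<in> virtual_marks G" "H \<subseteq> carrier G" "H \<subseteq> L" "L \<subseteq> generate G H"
  shows "f L = f H"
proof -
  have "fixed_points L S = fixed_points H S" if S: "finite_gset G S" for S :: "('a, nat) gset"
  proof
    show "fixed_points L S \<subseteq> fixed_points H S" using assms(3) by (auto simp: fixed_points_def)
    show "fixed_points H S \<subseteq> fixed_points L S"
    proof
      fix x assume x: "x \<in> fixed_points H S"
      then have "H \<subseteq> gset_stab G S x" and xS: "x \<in> fst S"
        using assms(2) by (auto simp: fixed_points_def gset_stab_def)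
      then have "L \<subseteq> gset_stab G S x"
        using assms(4) generate_subgroup_incl[OF _ gset_stab_subgroup[OF S xS]] by blast
      then show "x \<in> fixed_points L S" using xS by (auto simp: fixed_points_def gset_stab_def)
    qed
  qed
  moreover have "H \<inter> carrier G = H" "L \<inter> carrier G = L"
    using assms(2,4) generate_incl[OF assms(2)] by auto
  ultimately show ?thesis
    using assms(1) by (elim virtual_marksE) (simp add: mark_def)
qed

lemma virtual_mark_insert_one:
  assumes f: "f \<in> virtual_marks G"
  shows "f (insert \<one> H) = f H"
proof -
  have "f (insert \<one> (H \<inter> carrier G)) = f (H \<inter> carrier G)"
    by (rule virtual_mark_generate[OF f]) (auto intro: generate.one generate.incl)
  moreover have "insert \<one> (H \<inter> carrier G) = insert \<one> H \<inter> carrier G" by auto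
  ultimately show ?thesis using virtual_mark_Int_carrier[OF f] by metis
qed

lemma core_trivial_marks_one: "1 \<in> core_trivial_marks G"
  by (simp add: core_trivial_marks_def virtual_marks_one)

lemma core_trivial_marks_mult:
  assumes "f \<in> core_trivial_marks G" "g \<in> core_trivial_marks G"
  shows "f * g \<in> core_trivial_marks G"
proof -
  have "(f * g) * (f * g) = (f * f) * (g * g)" by (simp add: ac_simps)
  also have "\<dots> = 1" using assms by (simp add: core_trivial_marks_def)
  finally show ?thesis using assms by (simp add: core_trivial_marks_def virtual_marks_mult)
qed

lemma core_trivial_marks_prod:
  "(\<And>i. i \<in> I \<Longrightarrow> f i \<in> core_trivial_marks G) \<Longrightarrow> (\<Prod>i\<in>I. f i) \<in> core_trivial_marks G"
  by (induction I rule: infinite_finite_induct)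
    (auto simp: core_trivial_marks_one core_trivial_marks_mult)

text \<open>The defining condition for \<open>K\<close> the whole group and \<open>g\<close> the
  neutral element. It is the reason why an inflated unit becomes trivial in the other
  factors.\<close>

lemma core_trivial_marks_carrier: "f \<in> core_trivial_marks G \<Longrightarrow> f (carrier G) = 1"
  using core_trivial_marksD(3)[of f G, OF _ normal_self one_closed] insert_absorb[OF one_closed]
  by simp

end

section \<open>Direct products\<close>

lemma prod_fun_apply: "(\<Prod>i\<in>I. F i) x = (\<Prod>i\<in>I. F i x)" for F :: "'i \<Rightarrow> 'x \<Rightarrow> int"
  by (induction I rule: infinite_finite_induct) auto

locale fin_group_family =
  fixes I :: "'i set" and G :: "'i \<Rightarrow> ('a, 'm) monoid_scheme"
  assumes finite_index: "finite I"
    and fin_group_factor: "\<And>i. i \<in> I \<Longrightarrow> fin_group (G i)"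
begin

abbreviation P :: "('i \<Rightarrow> 'a) monoid" where
  "P \<equiv> product_group I G"

sublocale P: fin_group P
proof -
  have "group P" using fin_group_factor by (simp add: fin_group_def)
  moreover have "finite (carrier P)"
    using fin_group_factor finite_index
    by (auto simp: fin_group_def fin_group_axioms_def intro!: finite_PiE)
  ultimately show "fin_group P" by (simp add: fin_group_def fin_group_axioms_def)
qed

section \<open>Projections, cofactors and fibres\<close>

lemma group_factor: "i \<in> I \<Longrightarrow> group (G i)"
  using fin_group_factor by (simp add: fin_group_def)

lemma proj_hom: "i \<in> I \<Longrightarrow> (\<lambda>x. x i) \<in> hom P (G i)"
  by (rule homI) auto

lemma proj_group_hom: "i \<in> I \<Longrightarrow> group_hom P (G i) (\<lambda>x. x i)"
  using proj_hom group_factor by (simp add: group_hom_def group_hom_axioms_def P.is_group)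

lemma ex_coordinates:
  assumes "J \<subseteq> I" "\<And>i. i \<in> J \<Longrightarrow> y i \<in> carrier (G i)"
  shows "\<exists>x\<in>carrier P. \<forall>i\<in>J. x i = y i"
  using assms group_factor
  by (intro bexI[of _ "\<lambda>i\<in>I. if i \<in> J then y i else \<one>\<^bsub>G i\<^esub>"]) (auto simp: group.is_monoid)

lemma proj_surj:
  assumes "i \<in> I"
  shows "(\<lambda>x. x i) ` carrier P = carrier (G i)"
proof
  show "carrier (G i) \<subseteq> (\<lambda>x. x i) ` carrier P"
  proof
    fix y assume "y \<in> carrier (G i)"
    then obtain x where "x \<in> carrier P" "x i = y"
      using ex_coordinates[of "{i}" "\<lambda>_. y"] assms by auto
    then show "y \<in> (\<lambda>x. x i) ` carrier P" by blast
  qed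
qed (use assms in auto)

lemma cofactor_normal:
  assumes "i \<in> I"
  shows "cofactor I G i \<lhd> P"
proof -
  have "cofactor I G i = kernel P (G i) (\<lambda>x. x i)"
    by (auto simp: cofactor_def kernel_def)
  then show ?thesis using group_hom.normal_kernel[OF proj_group_hom[OF assms]] by simp
qed

lemma fibre_eq_r_coset:
  assumes i: "i \<in> I" and x: "x \<in> carrier P"
  shows "fibre I G i (x i) = cofactor I G i #>\<^bsub>P\<^esub> x"
proof -
  interpret p: group_hom P "G i" "\<lambda>x. x i" by (rule proj_group_hom[OF i])
  show ?thesis
  proof
    show "fibre I G i (x i) \<subseteq> cofactor I G i #>\<^bsub>P\<^esub> x"
    proof
      fix z assume z: "z \<in> fibre I G i (x i)"
      then have "z \<in> carrier P" "z i = x i" by (auto simp: fibre_def simp del: carrier_product_group)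
      then have "z \<otimes>\<^bsub>P\<^esub> inv\<^bsub>P\<^esub> x \<in> cofactor I G i"
        using x p.hom_mult[of z "inv\<^bsub>P\<^esub> x"] p.hom_inv[OF x] p.hom_closed[OF x] p.H.r_inv
        by (simp add: cofactor_def del: carrier_product_group mult_product_group inv_product_group)
      moreover have "z = z \<otimes>\<^bsub>P\<^esub> inv\<^bsub>P\<^esub> x \<otimes>\<^bsub>P\<^esub> x"
        using x \<open>z \<in> carrier P\<close>
        by (simp add: P.m_assoc
            del: carrier_product_group mult_product_group inv_product_group one_product_group)
      ultimately show "z \<in> cofactor I G i #>\<^bsub>P\<^esub> x" unfolding r_coset_def by blast
    qed
    show "cofactor I G i #>\<^bsub>P\<^esub> x \<subseteq> fibre I G i (x i)"
    proof
      fix z assume "z \<in> cofactor I G i #>\<^bsub>P\<^esub> x"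
      then obtain n where n: "n \<in> carrier P" "n i = \<one>\<^bsub>G i\<^esub>" "z = n \<otimes>\<^bsub>P\<^esub> x"
        unfolding r_coset_def cofactor_def by blast
      then show "z \<in> fibre I G i (x i)"
        using p.hom_mult[OF n(1) x] P.m_closed[OF n(1) x] p.hom_closed[OF x] p.H.l_one
        by (simp add: fibre_def del: carrier_product_group mult_product_group)
    qed
  qed
qed

lemma fibre_hom:
  assumes i: "i \<in> I"
  shows "fibre I G i \<in> hom (G i) (P Mod cofactor I G i)"
proof (rule homI)
  have rep: "\<exists>x\<in>carrier P. y = x i" if "y \<in> carrier (G i)" for y
    using that unfolding proj_surj[OF i, symmetric] by blast
  show "fibre I G i y \<in> carrier (P Mod cofactor I G i)" if "y \<in> carrier (G i)" for y
    using rep[OF that] fibre_eq_r_coset[OF i] unfolding carrier_FactGroup by blast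
  fix y z assume "y \<in> carrier (G i)" "z \<in> carrier (G i)"
  then obtain a b where ab: "a \<in> carrier P" "y = a i" "b \<in> carrier P" "z = b i"
    using rep by meson
  have "fibre I G i ((a \<otimes>\<^bsub>P\<^esub> b) i) = (cofactor I G i #>\<^bsub>P\<^esub> a) <#>\<^bsub>P\<^esub> (cofactor I G i #>\<^bsub>P\<^esub> b)"
    unfolding normal.rcos_sum[OF cofactor_normal[OF i] ab(1,3)]
    by (rule fibre_eq_r_coset[OF i P.m_closed[OF ab(1,3)]])
  then show "fibre I G i (y \<otimes>\<^bsub>G i\<^esub> z) = fibre I G i y \<otimes>\<^bsub>P Mod cofactor I G i\<^esub> fibre I G i z"
    using i fibre_eq_r_coset[OF i ab(1)] fibre_eq_r_coset[OF i ab(3)] by (simp add: ab FactGroup_def)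
qed

section \<open>Restriction to a factor and inflation from it, on marks\<close>

definition res_mark :: "'i \<Rightarrow> (('i \<Rightarrow> 'a) set \<Rightarrow> int) \<Rightarrow> 'a set \<Rightarrow> int" where
  "res_mark i f H = f {x \<in> carrier P. x i \<in> insert \<one>\<^bsub>G i\<^esub> H}"

definition infl_mark :: "'i \<Rightarrow> ('a set \<Rightarrow> int) \<Rightarrow> ('i \<Rightarrow> 'a) set \<Rightarrow> int" where
  "infl_mark i f H = f ((\<lambda>x. x i) ` (H \<inter> carrier P))"

text \<open>The formulas for fixed points and for pullback along \<open>fibre\<close> combine to
  evaluation at the preimage of \<open>H\<close> under the projection. The neutral element adjoined
  in \<open>res_mark\<close> accounts for the cofactor, which is its fibre.\<close>

lemma factor_fix_class_of_mark:
  assumes i: "i \<in> I" and f: "f \<in> virtual_marks P"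
  shows "factor_fix I G i (class_of_mark P f) = class_of_mark (G i) (res_mark i f)"
    and "res_mark i f \<in> virtual_marks (G i)"
proof -
  interpret Gi: fin_group "G i" by (rule fin_group_factor[OF i])
  let ?N = "cofactor I G i"
  have N: "?N \<lhd> P" by (rule cofactor_normal[OF i])
  note Q = P.fin_group_FactGroup[OF N]
  let ?g = "\<lambda>H. f (?N \<union> \<Union>(H \<inter> carrier (P Mod ?N)))"
  note g = P.burnside_fix_class_of_mark[OF N f]
  have "?g (fibre I G i ` (H \<inter> carrier (G i))) = res_mark i f H" for H
  proof -
    have "fibre I G i ` (H \<inter> carrier (G i)) \<inter> carrier (P Mod ?N) = fibre I G i ` (H \<inter> carrier (G i))"
      using fibre_hom[OF i] by (auto simp: hom_def)
    moreover have "?N \<union> \<Union>(fibre I G i ` (H \<inter> carrier (G i))) =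
        {x \<in> carrier P. x i \<in> insert \<one>\<^bsub>G i\<^esub> H}"
      using i by (auto simp: cofactor_def fibre_def)
    ultimately show ?thesis by (simp only: res_mark_def)
  qed
  then have eq: "(\<lambda>H. ?g (fibre I G i ` (H \<inter> carrier (G i)))) = res_mark i f" by blast
  show "factor_fix I G i (class_of_mark P f) = class_of_mark (G i) (res_mark i f)"
    using Gi.burnside_pullback_class_of_mark(1)[OF Q fibre_hom[OF i] g(2)]
    unfolding factor_fix_def g(1) eq .
  show "res_mark i f \<in> virtual_marks (G i)"
    using Gi.burnside_pullback_class_of_mark(2)[OF Q fibre_hom[OF i] g(2)] unfolding eq .
qed

lemma res_mark_mult: "res_mark i (f * g) = res_mark i f * res_mark i g"
  by (simp add: res_mark_def fun_eq_iff)

lemma infl_mark_mult: "infl_mark i (f * g) = infl_mark i f * infl_mark i g"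
  by (simp add: infl_mark_def fun_eq_iff)

lemma res_mark_one: "res_mark i 1 = 1"
  by (simp add: res_mark_def fun_eq_iff)

lemma infl_mark_one: "infl_mark i 1 = 1"
  by (simp add: infl_mark_def fun_eq_iff)

text \<open>The preimage \<open>?K\<close> of \<open>K\<close> is normal in the product. Evaluation
  takes place at \<open>?L\<close>, the preimage of \<open>K\<close> together with \<open>g\<close>
  and the neutral element; it lies between \<open>insert h ?K\<close> and the subgroup generated by
  that set, where \<open>h\<close> is any lift of \<open>g\<close>. So core-triviality of
  \<open>f\<close> applies to \<open>?K\<close> and \<open>h\<close>.\<close>

lemma res_mark_core_trivial:
  assumes i: "i \<in> I" and f: "f \<in> core_trivial_marks P"
  shows "res_mark i f \<in> core_trivial_marks (G i)"
proof -
  interpret p: group_hom P "G i" "\<lambda>x. x i" by (rule proj_group_hom[OF i])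
  note fV = core_trivial_marksD(1)[OF f]
  have "res_mark i f (insert g K) = 1" if K: "K \<lhd> G i" and g: "g \<in> carrier (G i)" for K g
  proof -
    let ?K = "{x \<in> carrier P. x i \<in> K}" and ?L = "{x \<in> carrier P. x i \<in> insert \<one>\<^bsub>G i\<^esub> (insert g K)}"
    have K': "subgroup K (G i)" by (rule normal_imp_subgroup[OF K])
    obtain h where h: "h \<in> carrier P" "h i = g" using g unfolding proj_surj[OF i, symmetric] by blast
    have norm: "?K \<lhd> P"
      unfolding P.normal_inv_iff
    proof (intro conjI ballI)
      show "subgroup ?K P"
      proof (rule P.subgroupI)
        have "\<one>\<^bsub>P\<^esub> \<in> ?K"
          using subgroup.one_closed[OF K'] p.hom_one
          by (simp del: carrier_product_group one_product_group)
        then show "?K \<noteq> {}" by blast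
      qed (auto simp: subgroup.m_closed[OF K'] subgroup.m_inv_closed[OF K'] p.hom_mult p.hom_inv
          simp del: carrier_product_group mult_product_group inv_product_group)
      fix x k assume x: "x \<in> carrier P" and k: "k \<in> ?K"
      then have "x i \<otimes>\<^bsub>G i\<^esub> k i \<otimes>\<^bsub>G i\<^esub> inv\<^bsub>G i\<^esub> (x i) \<in> K"
        by (intro normal.inv_op_closed2[OF K]) (auto intro: p.hom_closed)
      with x k show "x \<otimes>\<^bsub>P\<^esub> k \<otimes>\<^bsub>P\<^esub> inv\<^bsub>P\<^esub> x \<in> ?K"
        by (simp add: p.hom_mult p.hom_inv del: carrier_product_group mult_product_group inv_product_group)
    qed
    have sub: "insert h ?K \<subseteq> carrier P" using h by blast
    have "f ?L = f (insert h ?K)"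
    proof (rule P.virtual_mark_generate[OF fV sub])
      show "insert h ?K \<subseteq> ?L" using h by blast
      show "?L \<subseteq> generate P (insert h ?K)"
      proof
        fix x assume x: "x \<in> ?L"
        show "x \<in> generate P (insert h ?K)"
        proof (cases "x i = g")
          case True
          \<comment> \<open>Two lifts of \<open>g\<close> differ by an element of the cofactor,
            which is contained in \<open>?K\<close>.\<close>
          have "inv\<^bsub>P\<^esub> h \<otimes>\<^bsub>P\<^esub> x \<in> ?K"
            using True x h g subgroup.one_closed[OF K']
            by (simp add: p.hom_mult p.hom_inv
                del: carrier_product_group mult_product_group inv_product_group)
          then have "h \<otimes>\<^bsub>P\<^esub> (inv\<^bsub>P\<^esub> h \<otimes>\<^bsub>P\<^esub> x) \<in> generate P (insert h ?K)"
            by (intro generate.eng generate.incl) auto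
          moreover have "h \<otimes>\<^bsub>P\<^esub> (inv\<^bsub>P\<^esub> h \<otimes>\<^bsub>P\<^esub> x) = x"
            by (rule P.inv_mult_cancel(2)) (use h x in auto)
          ultimately show ?thesis by simp
        next
          case False
          then have "x \<in> ?K" using x subgroup.one_closed[OF K'] by auto
          then show ?thesis by (intro generate.incl) blast
        qed
      qed
    qed
    also have "\<dots> = 1" by (rule core_trivial_marksD(3)[OF f norm h(1)])
    finally show ?thesis by (simp only: res_mark_def)
  qed
  moreover have "res_mark i f * res_mark i f = 1"
    unfolding res_mark_mult[symmetric] core_trivial_marksD(2)[OF f] by (rule res_mark_one)
  ultimately show ?thesis
    using factor_fix_class_of_mark(2)[OF i fV] unfolding core_trivial_marks_def by blast
qed

text \<open>The projection is surjective, so the image of a normal subgroup is normal and the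
  condition on \<open>f\<close> applies to this image.\<close>

lemma infl_mark_core_trivial:
  assumes i: "i \<in> I" and f: "f \<in> core_trivial_marks (G i)"
  shows "infl_mark i f \<in> core_trivial_marks P"
proof -
  note fV = core_trivial_marksD(1)[OF f]
  have "infl_mark i f (insert g K) = 1" if K: "K \<lhd> P" and g: "g \<in> carrier P" for K g
  proof -
    have "insert g K \<inter> carrier P = insert g K"
      using g subgroup.subset[OF normal_imp_subgroup[OF K]] by blast
    then have "infl_mark i f (insert g K) = f (insert (g i) ((\<lambda>x. x i) ` K))"
      by (simp only: infl_mark_def image_insert)
    also have "\<dots> = 1"
      using normal.surj_hom_normal_subgroup[OF K proj_group_hom[OF i] proj_surj[OF i]]
        group_hom.hom_closed[OF proj_group_hom[OF i] g]
      by (rule core_trivial_marksD(3)[OF f])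
    finally show ?thesis .
  qed
  moreover have "infl_mark i f * infl_mark i f = 1"
    unfolding infl_mark_mult[symmetric] core_trivial_marksD(2)[OF f] by (rule infl_mark_one)
  moreover have "infl_mark i f \<in> virtual_marks P"
    using P.burnside_pullback_class_of_mark(2)[OF fin_group_factor[OF i] proj_hom[OF i] fV]
    by (simp only: infl_mark_def[abs_def])
  ultimately show ?thesis unfolding core_trivial_marks_def by blast
qed

text \<open>By surjectivity, projecting the preimage of \<open>H\<close> with the neutral element
  returns this set, cut down to the carrier. Virtual marks ignore both modifications.\<close>

lemma res_infl_mark_same:
  assumes i: "i \<in> I" and f: "f \<in> virtual_marks (G i)"
  shows "res_mark i (infl_mark i f) = f"
proof
  interpret Gi: fin_group "G i" by (rule fin_group_factor[OF i])
  fix H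
  have "(\<lambda>x. x i) ` ({x \<in> carrier P. x i \<in> insert \<one>\<^bsub>G i\<^esub> H} \<inter> carrier P) =
      (\<lambda>x. x i) ` carrier P \<inter> insert \<one>\<^bsub>G i\<^esub> H"
    by blast
  then have "res_mark i (infl_mark i f) H = f (carrier (G i) \<inter> insert \<one>\<^bsub>G i\<^esub> H)"
    by (simp only: res_mark_def infl_mark_def proj_surj[OF i])
  then show "res_mark i (infl_mark i f) H = f H"
    by (simp add: Int_commute Gi.virtual_mark_Int_carrier[OF f] Gi.virtual_mark_insert_one[OF f])
qed

text \<open>The set at which the inflated mark is evaluated contains the cofactor of
  \<open>i\<close>, so its projection to coordinate \<open>j\<close> is the whole of
  \<open>G j\<close>, where \<open>f\<close> has value 1.\<close>

lemma res_infl_mark_other: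
  assumes i: "i \<in> I" and j: "j \<in> I" "j \<noteq> i" and f: "f \<in> core_trivial_marks (G j)"
  shows "res_mark i (infl_mark j f) = 1"
proof
  interpret Gj: fin_group "G j" by (rule fin_group_factor[OF j(1)])
  fix H
  have "carrier (G j) \<subseteq> (\<lambda>x. x j) ` ({x \<in> carrier P. x i \<in> insert \<one>\<^bsub>G i\<^esub> H} \<inter> carrier P)"
  proof
    fix y assume "y \<in> carrier (G j)"
    then have "\<exists>x\<in>carrier P. \<forall>k\<in>{i, j}. x k = (if k = i then \<one>\<^bsub>G i\<^esub> else y)"
      using i j monoid.one_closed[OF group.is_monoid[OF group_factor[OF i]]]
      by (intro ex_coordinates) auto
    then obtain x where "x \<in> carrier P" "x i = \<one>\<^bsub>G i\<^esub>" "x j = y"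
      using j(2) by (auto simp del: carrier_product_group)
    then show "y \<in> (\<lambda>x. x j) ` ({x \<in> carrier P. x i \<in> insert \<one>\<^bsub>G i\<^esub> H} \<inter> carrier P)" by blast
  qed
  moreover have "(\<lambda>x. x j) ` ({x \<in> carrier P. x i \<in> insert \<one>\<^bsub>G i\<^esub> H} \<inter> carrier P) \<subseteq> carrier (G j)"
    using j by auto
  ultimately have "(\<lambda>x. x j) ` ({x \<in> carrier P. x i \<in> insert \<one>\<^bsub>G i\<^esub> H} \<inter> carrier P) = carrier (G j)"
    by blast
  then show "res_mark i (infl_mark j f) H = 1 H"
    by (simp only: res_mark_def infl_mark_def Gj.core_trivial_marks_carrier[OF f] one_fun_apply)
qed

section \<open>The section of the restriction maps\<close>

definition prod_infl_mark :: "('i \<Rightarrow> 'a set \<Rightarrow> int) \<Rightarrow> ('i \<Rightarrow> 'a) set \<Rightarrow> int" where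
  "prod_infl_mark v = (\<Prod>i\<in>I. infl_mark i (v i))"

lemma prod_infl_mark_cong:
  "(\<And>i. i \<in> I \<Longrightarrow> v i = w i) \<Longrightarrow> prod_infl_mark v = prod_infl_mark w"
  by (simp add: prod_infl_mark_def)

lemma prod_infl_mark_mult:
  "prod_infl_mark (\<lambda>i. v i * w i) = prod_infl_mark v * prod_infl_mark w"
  by (simp add: prod_infl_mark_def infl_mark_mult prod.distrib)

lemma prod_infl_mark_core_trivial:
  "(\<And>i. i \<in> I \<Longrightarrow> v i \<in> core_trivial_marks (G i)) \<Longrightarrow> prod_infl_mark v \<in> core_trivial_marks P"
  unfolding prod_infl_mark_def by (intro P.core_trivial_marks_prod infl_mark_core_trivial)

text \<open>Restriction is evaluation at a fixed set, so it passes through the product; the factors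
  with index other than \<open>i\<close> restrict to 1.\<close>

lemma res_prod_infl_mark:
  assumes i: "i \<in> I" and v: "\<And>i. i \<in> I \<Longrightarrow> v i \<in> core_trivial_marks (G i)"
  shows "res_mark i (prod_infl_mark v) = v i"
proof
  fix H
  have "res_mark i (prod_infl_mark v) H = (\<Prod>j\<in>I. res_mark i (infl_mark j (v j)) H)"
    by (simp only: prod_infl_mark_def res_mark_def prod_fun_apply)
  also have "\<dots> = (\<Prod>j\<in>I. if j = i then v i H else 1)"
    using i v by (intro prod.cong refl)
      (auto simp: res_infl_mark_same[OF i core_trivial_marksD(1)[OF v[OF i]]] res_infl_mark_other)
  also have "\<dots> = v i H" using i finite_index by simp
  finally show "res_mark i (prod_infl_mark v) H = v i H" .
qed

abbreviation U_ker :: "('i \<Rightarrow> 'a) burnside monoid" where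
  "U_ker \<equiv> (core_trivial_units P) \<lparr>carrier := carrier (core_trivial_units P) \<inter>
    (\<Inter>i\<in>I. kernel (core_trivial_units P) (core_trivial_units (G i)) (factor_fix I G i))\<rparr>"

lemma carrier_U_ker:
  "carrier U_ker = class_of_mark P ` {f \<in> core_trivial_marks P. \<forall>i\<in>I. res_mark i f = 1}"
proof -
  have iff: "factor_fix I G i (class_of_mark P f) = \<one>\<^bsub>core_trivial_units (G i)\<^esub> \<longleftrightarrow> res_mark i f = 1"
    if "i \<in> I" "f \<in> core_trivial_marks P" for i f
  proof -
    interpret Gi: fin_group "G i" by (rule fin_group_factor[OF that(1)])
    note f = factor_fix_class_of_mark[OF that(1) core_trivial_marksD(1)[OF that(2)]]
    show ?thesis
      unfolding f(1) Gi.one_core_trivial_units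
      by (rule inj_on_eq_iff[OF inj_on_class_of_mark f(2) Gi.virtual_marks_one])
  qed
  have "u \<in> carrier U_ker \<longleftrightarrow> (\<exists>f\<in>core_trivial_marks P. u = class_of_mark P f \<and>
      (\<forall>i\<in>I. factor_fix I G i (class_of_mark P f) = \<one>\<^bsub>core_trivial_units (G i)\<^esub>))" for u
    by (simp add: kernel_def P.carrier_core_trivial_units) blast
  then have "u \<in> carrier U_ker \<longleftrightarrow> (\<exists>f\<in>core_trivial_marks P. u = class_of_mark P f \<and>
      (\<forall>i\<in>I. res_mark i f = 1))" for u
    by (simp add: iff cong: ball_cong)
  then show ?thesis by blast
qed

text \<open>Core-trivial units square to one, so dividing \<open>f\<close> by the inflation of its restrictions is the
  same as multiplying by it.\<close>

theorem core_trivial_units_product_iso: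
  "core_trivial_units P \<cong> product_group I (\<lambda>i. core_trivial_units (G i)) \<times>\<times> U_ker"
proof -
  let ?C = "core_trivial_marks P"
  \<comment> \<open>The part of \<open>f\<close> that is inflated from the factors. It has the same
    restrictions as \<open>f\<close>, so multiplying \<open>f\<close> by it squares every
    restriction and lands in the common kernel.\<close>
  define s where "s f = prod_infl_mark (\<lambda>i. res_mark i f)" for f
  have s: "s f \<in> ?C" if "f \<in> ?C" for f
    unfolding s_def by (intro prod_infl_mark_core_trivial res_mark_core_trivial that)
  have res_s: "res_mark i (s f) = res_mark i f" if "i \<in> I" "f \<in> ?C" for i f
    unfolding s_def using that by (intro res_prod_infl_mark res_mark_core_trivial)
  have s_mult: "s (f * g) = s f * s g" for f g
    by (simp add: s_def res_mark_mult prod_infl_mark_mult)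
  define F where "F f = (\<lambda>i\<in>I. class_of_mark (G i) (res_mark i f), class_of_mark P (f * s f))" for f
  \<comment> \<open>The map \<open>F\<close> lives on marks; \<open>\<Phi>\<close> is its
    counterpart on elements of the Burnside ring.\<close>
  define \<Phi> where "\<Phi> u = F (the_inv_into (virtual_marks P) (class_of_mark P) u)" for u
  have \<Phi>: "\<Phi> (class_of_mark P f) = F f" if "f \<in> ?C" for f
    using core_trivial_marksD(1)[OF that] by (simp add: \<Phi>_def the_inv_into_f_f[OF inj_on_class_of_mark])
  let ?T = "product_group I (\<lambda>i. core_trivial_units (G i)) \<times>\<times> U_ker"
  have carT: "carrier ?T = (\<Pi>\<^sub>E i\<in>I. class_of_mark (G i) ` core_trivial_marks (G i)) \<times>
      class_of_mark P ` {f \<in> ?C. \<forall>i\<in>I. res_mark i f = 1}"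
    unfolding carrier_U_ker[symmetric] DirProd_def partial_object.simps carrier_product_group
    using fin_group.carrier_core_trivial_units[OF fin_group_factor]
    by (intro arg_cong2[where f = "(\<times>)"] PiE_cong refl) blast
  have ker: "f * s f \<in> {f \<in> ?C. \<forall>i\<in>I. res_mark i f = 1}" if f: "f \<in> ?C" for f
  proof -
    have "res_mark i (f * s f) = 1" if "i \<in> I" for i
      unfolding res_mark_mult res_s[OF that f]
      by (rule core_trivial_marksD(2)[OF res_mark_core_trivial[OF that f]])
    then show ?thesis using P.core_trivial_marks_mult[OF f s[OF f]] by blast
  qed
  have F_closed: "F f \<in> carrier ?T" if "f \<in> ?C" for f
    unfolding carT using that ker[OF that] res_mark_core_trivial by (auto simp: F_def)
  have F_mult: "F (f * g) = F f \<otimes>\<^bsub>?T\<^esub> F g" if f: "f \<in> ?C" and g: "g \<in> ?C" for f g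
  proof -
    have "class_of_mark (G i) (res_mark i (f * g)) = class_of_mark (G i) (res_mark i f)
        \<otimes>\<^bsub>core_trivial_units (G i)\<^esub> class_of_mark (G i) (res_mark i g)" if i: "i \<in> I" for i
    proof -
      interpret Gi: fin_group "G i" by (rule fin_group_factor[OF i])
      show ?thesis
        using res_mark_core_trivial[OF i f] res_mark_core_trivial[OF i g]
        by (simp add: Gi.mult_core_trivial_units Gi.burnside_ring_mult core_trivial_marksD res_mark_mult)
    qed
    moreover have "class_of_mark P (f * g * s (f * g)) =
        class_of_mark P (f * s f) \<otimes>\<^bsub>core_trivial_units P\<^esub> class_of_mark P (g * s g)"
    proof -
      have "f * g * s (f * g) = (f * s f) * (g * s g)" by (simp add: s_mult ac_simps)
      then show ?thesis
        using P.core_trivial_marks_mult[OF f s[OF f]] P.core_trivial_marks_mult[OF g s[OF g]]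
        by (simp only: P.mult_core_trivial_units P.burnside_ring_mult core_trivial_marksD(1))
    qed
    ultimately show ?thesis by (simp add: F_def DirProd_def fun_eq_iff)
  qed
  have F_inj: "f = g" if f: "f \<in> ?C" and g: "g \<in> ?C" and eq: "F f = F g" for f g
  proof -
    have "res_mark i f = res_mark i g" if i: "i \<in> I" for i
    proof (rule inj_onD[OF inj_on_class_of_mark])
      show "class_of_mark (G i) (res_mark i f) = class_of_mark (G i) (res_mark i g)"
        using eq i by (auto simp: F_def dest!: fun_cong[where x = i])
    qed (use i f g res_mark_core_trivial core_trivial_marksD(1) in blast)+
    then have "s f = s g" unfolding s_def by (rule prod_infl_mark_cong)
    moreover have "f * s f = g * s g"
    proof (rule inj_onD[OF inj_on_class_of_mark])
      show "class_of_mark P (f * s f) = class_of_mark P (g * s g)"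
        using eq by (simp add: F_def)
    qed (use ker f g core_trivial_marksD(1) in blast)+
    \<comment> \<open>The first components give \<open>s f = s g\<close> and the second give
      \<open>f * s f = g * s g\<close>; multiplying once more by \<open>s f\<close>, whose square is
      1, frees \<open>f\<close> and \<open>g\<close>.\<close>
    ultimately have "f * (s f * s f) = g * (s f * s f)"
      by (metis mult.assoc)
    then show ?thesis using core_trivial_marksD(2)[OF s[OF f]] by simp
  qed
  have F_surj: "\<exists>f\<in>?C. F f = t" if t: "t \<in> carrier ?T" for t
  proof -
    obtain v k where t: "t = (v, k)" "v \<in> (\<Pi>\<^sub>E i\<in>I. class_of_mark (G i) ` core_trivial_marks (G i))"
      "k \<in> class_of_mark P ` {f \<in> ?C. \<forall>i\<in>I. res_mark i f = 1}"
      using t unfolding carT by blast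
    then obtain h where h: "k = class_of_mark P h" "h \<in> ?C" "\<And>i. i \<in> I \<Longrightarrow> res_mark i h = 1"
      by blast
    have "\<forall>i\<in>I. \<exists>w\<in>core_trivial_marks (G i). v i = class_of_mark (G i) w"
      using t(2) by (auto simp: PiE_iff image_iff)
    then obtain w where w: "\<And>i. i \<in> I \<Longrightarrow> w i \<in> core_trivial_marks (G i)"
      "\<And>i. i \<in> I \<Longrightarrow> v i = class_of_mark (G i) (w i)"
      by metis
    \<comment> \<open>The preimage of \<open>(v, k)\<close> is \<open>h * ?p\<close>: the kernel
      part \<open>h\<close> has trivial restrictions, so those of the product are the
      \<open>w i\<close>. Hence \<open>s (h * ?p) = ?p\<close>, and the second component is
      \<open>h\<close> because \<open>?p\<close> squares to 1.\<close>
    let ?p = "prod_infl_mark w"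
    have p: "?p \<in> ?C" by (rule prod_infl_mark_core_trivial[OF w(1)])
    have res: "res_mark i (h * ?p) = w i" if "i \<in> I" for i
      using res_prod_infl_mark[OF that, of w] w(1) by (simp add: res_mark_mult h(3)[OF that])
    have "s (h * ?p) = ?p" unfolding s_def using res by (rule prod_infl_mark_cong)
    then have "h * ?p * s (h * ?p) = h"
      using core_trivial_marksD(2)[OF p] by (simp add: mult.assoc)
    moreover have "(\<lambda>i\<in>I. class_of_mark (G i) (res_mark i (h * ?p))) = v"
      using t(2) by (intro extensionalityI[of _ I]) (auto simp: res w(2) PiE_def)
    ultimately have "F (h * ?p) = t" by (simp add: F_def t(1) h(1))
    then show ?thesis using P.core_trivial_marks_mult[OF h(2) p] by blast
  qed
  have "\<Phi> \<in> iso (core_trivial_units P) ?T"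
  proof (rule isoI)
    show "\<Phi> \<in> hom (core_trivial_units P) ?T"
    proof (rule homI)
      fix u assume u: "u \<in> carrier (core_trivial_units P)"
      then obtain f where f: "f \<in> ?C" "u = class_of_mark P f"
        unfolding P.carrier_core_trivial_units by blast
      show "\<Phi> u \<in> carrier ?T"
        unfolding f(2) \<Phi>[OF f(1)] by (rule F_closed[OF f(1)])
      fix u' assume "u' \<in> carrier (core_trivial_units P)"
      then obtain g where g: "g \<in> ?C" "u' = class_of_mark P g"
        unfolding P.carrier_core_trivial_units by blast
      have "u \<otimes>\<^bsub>core_trivial_units P\<^esub> u' = class_of_mark P (f * g)"
        using f g by (simp add: P.mult_core_trivial_units P.burnside_ring_mult core_trivial_marksD)
      then show "\<Phi> (u \<otimes>\<^bsub>core_trivial_units P\<^esub> u') = \<Phi> u \<otimes>\<^bsub>?T\<^esub> \<Phi> u'"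
        using \<Phi>[OF P.core_trivial_marks_mult[OF f(1) g(1)]] F_mult[OF f(1) g(1)]
          \<Phi>[OF f(1)] \<Phi>[OF g(1)]
        by (simp only: f(2) g(2))
    qed
    show "bij_betw \<Phi> (carrier (core_trivial_units P)) (carrier ?T)"
    proof (rule bij_betw_imageI)
      show "inj_on \<Phi> (carrier (core_trivial_units P))"
        unfolding P.carrier_core_trivial_units
      proof (rule inj_onI)
        fix u u' assume "u \<in> class_of_mark P ` ?C" "u' \<in> class_of_mark P ` ?C" "\<Phi> u = \<Phi> u'"
        then obtain f g where fg: "f \<in> ?C" "g \<in> ?C" "u = class_of_mark P f" "u' = class_of_mark P g"
          "\<Phi> (class_of_mark P f) = \<Phi> (class_of_mark P g)"
          by blast
        then have "f = g" using F_inj[OF fg(1,2)] \<Phi>[OF fg(1)] \<Phi>[OF fg(2)] by (simp only:)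
        then show "u = u'" using fg(3,4) by (simp only:)
      qed
      have "\<Phi> ` carrier (core_trivial_units P) = F ` ?C"
        unfolding P.carrier_core_trivial_units image_image by (rule image_cong[OF refl \<Phi>])
      also have "\<dots> = carrier ?T"
      proof
        show "F ` ?C \<subseteq> carrier ?T" using F_closed by (rule image_subsetI)
        show "carrier ?T \<subseteq> F ` ?C"
        proof
          fix t assume "t \<in> carrier ?T"
          from F_surj[OF this] show "t \<in> F ` ?C" by (elim bexE) (erule subst, rule imageI)
        qed
      qed
      finally show "\<Phi> ` carrier (core_trivial_units P) = carrier ?T" .
    qed
  qed
  then show ?thesis by (rule is_isoI)
qed

end

theorem corollary6p17:
  fixes G :: "nat \<Rightarrow> ('a, 'b) monoid_scheme" and m :: nat
  assumes "\<And>i. i \<in> {1..m} \<Longrightarrow> group (G i)"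
    and "\<And>i. i \<in> {1..m} \<Longrightarrow> finite (carrier (G i))"
  shows "core_trivial_units (product_group {1..m} G) \<cong>
    product_group {1..m} (\<lambda>i. core_trivial_units (G i)) \<times>\<times>
    (core_trivial_units (product_group {1..m} G))
      \<lparr>carrier := carrier (core_trivial_units (product_group {1..m} G)) \<inter>
        (\<Inter>i\<in>{1..m}. kernel (core_trivial_units (product_group {1..m} G))
                             (core_trivial_units (G i)) (factor_fix {1..m} G i))\<rparr>"
proof -
  interpret fin_group_family "{1..m}" G
    by (rule fin_group_family.intro) (use assms in \<open>simp_all add: fin_group_def fin_group_axioms_def\<close>)
  show ?thesis by (rule core_trivial_units_product_iso)
qed

end
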